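(* Let $\Gamma(V,E)$ be an $(n,n-2,d)$-max-by-abelian graph, and write $\{v_1,v_2\}=V\setminus V_{\max}$. Suppose that $V$ is the disjoint union of $lk(v_1)$ and $lk(v_2)$. Then $A_{\Gamma}$ has the $R_\infty$-property.
   Context: A graph is a finite simple non-empty graph $\Gamma(V,E)$; it is complete if every two distinct vertices are joined by an edge, and regular if all vertices have the same degree. For $v\in V$, $lk(v)$ is the set of vertices adjacent to $v$. $\Delta(\Gamma)$ is the maximal degree of $\Gamma$, and $V_{\max}=\{v\in V\mid \deg(v)=\Delta(\Gamma)\}$. For $W\subseteq V$, $\Gamma(W)$ is the subgraph induced on $W$. $\Gamma$ is $(n,k,d)$-max-by-abelian (or $(n,k,d)$-MBA) if $\Gamma$ is non-regular and connected, $\Gamma(V\setminus V_{\max})$ is complete, and $|V|=n$, $|V_{\max}|=k$, $\Delta(\Gamma)=d$. The right-angled Artin group associated to $\Gamma$ is $A_\Gamma=\langle V \mid [v,w],\ vw\in E\rangle$. For a group $G$ and $\varphi\in\operatorname{Aut}(G)$, elements $x,y\in G$ are $\varphi$-conjugate if $x=gy\varphi(g)^{-1}$ for some $g\in G$; the Reidemeister number $R(\varphi)$ is the number of $\varphi$-conjugacy classes ($\infty$ if there are infinitely many). $G$ has the $R_\infty$-property if $R(\varphi)=\infty$ for all $\varphi\in\operatorname{Aut}(G)$. *)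

theory Defs
  imports
    "Graph_Theory.Graph_Theory"
    "HOL-Algebra.Algebra"
    "HOL-Library.Extended_Nat"
begin

section \<open>Graphs\<close>

text \<open>
  Finite simple graphs are the members of the locale \<^locale>\<open>pair_graph\<close>: finite, loop-free and
  with a symmetric set of arcs, so that an edge vw is the pair of arcs (v, w), (w, v) and the
  out-degree of a vertex is its degree.  Non-emptiness is part of
  \<^const>\<open>Digraph_Component.connected\<close>.
\<close>

definition lk :: "'v pair_pre_digraph \<Rightarrow> 'v \<Rightarrow> 'v set" where
  "lk G v = {w \<in> pverts G. (v, w) \<in> parcs G}"

abbreviation degree :: "'v pair_pre_digraph \<Rightarrow> 'v \<Rightarrow> nat" where
  "degree G v \<equiv> out_degree (with_proj G) v"

definition max_degree :: "'v pair_pre_digraph \<Rightarrow> nat" where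
  "max_degree G = Max (degree G ` pverts G)"

definition max_verts :: "'v pair_pre_digraph \<Rightarrow> 'v set" where
  "max_verts G = {v \<in> pverts G. degree G v = max_degree G}"

definition regular_graph :: "'v pair_pre_digraph \<Rightarrow> bool" where
  "regular_graph G \<longleftrightarrow> (\<forall>v \<in> pverts G. \<forall>w \<in> pverts G. degree G v = degree G w)"

definition complete_graph :: "('v, 'a) pre_digraph \<Rightarrow> bool" where
  "complete_graph H \<longleftrightarrow> complete_digraph (card (verts H)) H"

definition max_by_abelian :: "nat \<Rightarrow> nat \<Rightarrow> nat \<Rightarrow> 'v pair_pre_digraph \<Rightarrow> bool" where
  "max_by_abelian n k d G \<longleftrightarrow>
     pair_graph G \<and>
     \<not> regular_graph G \<and>
     Digraph_Component.connected (with_proj G) \<and>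
     complete_graph (with_proj G \<restriction> (pverts G - max_verts G)) \<and>
     card (pverts G) = n \<and> card (max_verts G) = k \<and> max_degree G = d"

lemma degree_eq_card_lk:
  assumes "pair_graph G"
  shows "degree G v = card (lk G v)"
proof -
  interpret pair_graph G by fact
  have "bij_betw snd (out_arcs (with_proj G) v) (lk G v)"
    by (auto simp: bij_betw_def inj_on_def out_arcs_def lk_def image_iff dest: wellformed')
  then show ?thesis
    by (simp add: out_degree_def bij_betw_same_card)
qed

section \<open>Group presentations\<close>

text \<open>
  A word is a list of letters (s, e) with s a generator; (s, True) stands for s and (s, False)
  for its inverse.  The group presented by generators S and relators R is the set of words modulo
  the least congruence that cancels adjacent mutually inverse letters and identifies every
  relator with the empty word.
\<close>

type_synonym 's word = "('s \<times> bool) list"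

definition words :: "'s set \<Rightarrow> 's word set" where
  "words S = lists (S \<times> UNIV)"

inductive pres_eq :: "'s set \<Rightarrow> 's word set \<Rightarrow> 's word \<Rightarrow> 's word \<Rightarrow> bool"
  for S :: "'s set" and R :: "'s word set" where
  refl: "u \<in> words S \<Longrightarrow> pres_eq S R u u"
| sym: "pres_eq S R u v \<Longrightarrow> pres_eq S R v u"
| trans: "pres_eq S R u v \<Longrightarrow> pres_eq S R v w \<Longrightarrow> pres_eq S R u w"
| append: "pres_eq S R u u' \<Longrightarrow> pres_eq S R v v' \<Longrightarrow> pres_eq S R (u @ v) (u' @ v')"
| cancel: "s \<in> S \<Longrightarrow> pres_eq S R [(s, e), (s, \<not> e)] []"
| relator: "r \<in> R \<Longrightarrow> r \<in> words S \<Longrightarrow> pres_eq S R r []"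

definition pres_rel :: "'s set \<Rightarrow> 's word set \<Rightarrow> 's word rel" where
  "pres_rel S R = {(u, v). pres_eq S R u v}"

definition presented_group :: "'s set \<Rightarrow> 's word set \<Rightarrow> 's word set monoid" where
  "presented_group S R =
     \<lparr>carrier = words S // pres_rel S R,
      mult = (\<lambda>A B. pres_rel S R `` {a @ b | a b. a \<in> A \<and> b \<in> B}),
      one = pres_rel S R `` {[]}\<rparr>"

lemma words_simps [simp]:
  "[] \<in> words S"
  "x # u \<in> words S \<longleftrightarrow> fst x \<in> S \<and> u \<in> words S"
  "u @ v \<in> words S \<longleftrightarrow> u \<in> words S \<and> v \<in> words S"
  by (cases x; auto simp: words_def)+

lemma pres_eq_words: "pres_eq S R u v \<Longrightarrow> u \<in> words S \<and> v \<in> words S"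
  by (induction rule: pres_eq.induct) auto

lemma equiv_pres_rel: "equiv (words S) (pres_rel S R)"
  by (rule equivI)
    (auto simp: pres_rel_def refl_on_def dest: pres_eq_words
      intro: pres_eq.refl pres_eq.sym pres_eq.trans symI transI)

lemma presented_group_mult_class:
  assumes "u \<in> words S" "v \<in> words S"
  shows "pres_rel S R `` {u} \<otimes>\<^bsub>presented_group S R\<^esub> pres_rel S R `` {v} = pres_rel S R `` {u @ v}"
proof -
  have "pres_eq S R (u @ v) w"
    if "pres_eq S R u a" "pres_eq S R v b" "pres_eq S R (a @ b) w" for a b w
    using that by (blast intro: pres_eq.append pres_eq.trans)
  moreover have "pres_eq S R u u" "pres_eq S R v v"
    using assms by (auto intro: pres_eq.refl)
  ultimately show ?thesis
    by (fastforce simp: presented_group_def pres_rel_def)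
qed

lemma pres_eq_inverse:
  "u \<in> words S \<Longrightarrow> \<exists>v \<in> words S. pres_eq S R (v @ u) []"
proof (induction u)
  case Nil
  then show ?case by (auto intro!: bexI[of _ "[]"] pres_eq.refl)
next
  case (Cons x u)
  obtain s e where x: "x = (s, e)" by (cases x)
  from Cons obtain v where v: "v \<in> words S" "pres_eq S R (v @ u) []" by auto
  have s: "s \<in> S" and u: "u \<in> words S" using Cons.prems x by auto
  have "pres_eq S R ([(s, \<not> e), (s, e)] @ u) ([] @ u)"
    using pres_eq.cancel[OF s, of R "\<not> e"] u by (intro pres_eq.append) (auto intro: pres_eq.refl)
  then have "pres_eq S R (v @ [(s, \<not> e), (s, e)] @ u) (v @ [] @ u)"
    using v(1) by (intro pres_eq.append[OF pres_eq.refl])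
  with v(2) have "pres_eq S R ((v @ [(s, \<not> e)]) @ x # u) []"
    by (auto simp: x intro: pres_eq.trans)
  with v(1) s show ?case by (intro bexI[of _ "v @ [(s, \<not> e)]"]) auto
qed

lemma group_presented_group: "group (presented_group S R)"
proof -
  let ?G = "presented_group S R"
  let ?c = "\<lambda>u. pres_rel S R `` {u}"
  have carrier: "A \<in> carrier ?G \<longleftrightarrow> (\<exists>u \<in> words S. A = ?c u)" for A
    by (auto simp: presented_group_def quotient_def)
  have one: "\<one>\<^bsub>?G\<^esub> = ?c []"
    by (simp add: presented_group_def)
  show ?thesis
  proof (rule groupI)
    fix A assume "A \<in> carrier ?G"
    then obtain u where u: "u \<in> words S" "A = ?c u" by (auto simp: carrier)
    then obtain v where v: "v \<in> words S" "pres_eq S R (v @ u) []"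
      using pres_eq_inverse by blast
    then have "?c (v @ u) = ?c []"
      by (intro equiv_class_eq[OF equiv_pres_rel]) (simp add: pres_rel_def)
    with u v show "\<exists>B \<in> carrier ?G. B \<otimes>\<^bsub>?G\<^esub> A = \<one>\<^bsub>?G\<^esub>"
      by (intro bexI[of _ "?c v"]) (auto simp: carrier one presented_group_mult_class)
  qed (auto simp: carrier one presented_group_mult_class
      intro!: bexI[where P = "\<lambda>u. _ = pres_rel S R `` {u}"])
qed

section \<open>Right-angled Artin groups\<close>

definition commutator_word :: "'s \<Rightarrow> 's \<Rightarrow> 's word" where
  "commutator_word v w = [(v, True), (w, True), (v, False), (w, False)]"

definition raag :: "'v pair_pre_digraph \<Rightarrow> 'v word set monoid" where
  "raag G = presented_group (pverts G) {commutator_word v w | v w. (v, w) \<in> parcs G}"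

section \<open>Twisted conjugacy\<close>

definition twisted_conj :: "('a, 'b) monoid_scheme \<Rightarrow> ('a \<Rightarrow> 'a) \<Rightarrow> 'a rel" where
  "twisted_conj G \<phi> = {(x, y). x \<in> carrier G \<and> y \<in> carrier G \<and>
     (\<exists>g \<in> carrier G. x = g \<otimes>\<^bsub>G\<^esub> y \<otimes>\<^bsub>G\<^esub> inv\<^bsub>G\<^esub> (\<phi> g))}"

definition reidemeister_number :: "('a, 'b) monoid_scheme \<Rightarrow> ('a \<Rightarrow> 'a) \<Rightarrow> enat" where
  "reidemeister_number G \<phi> =
     (let C = carrier G // twisted_conj G \<phi> in if finite C then enat (card C) else \<infinity>)"

definition R_infinity :: "('a, 'b) monoid_scheme \<Rightarrow> bool" where
  "R_infinity G \<longleftrightarrow> (\<forall>\<phi> \<in> auto G. reidemeister_number G \<phi> = \<infinity>)"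

end

theory Submission
  imports Defs "Jordan_Normal_Form.Determinant"
begin

text \<open>
  Let \<open>\<phi>\<close> be an automorphism and let M be its matrix on the abelianization.  Exponent vectors of
  commuting elements are proportional on every pair of non-adjacent vertices, and a vertex w commutes
  with the \<open>deg w + 1\<close> independent elements of its star.  Comparing dimensions, M maps the span of
  \<open>V - {v1, v2}\<close> to itself, acts on the quotient spanned by \<open>v1, v2\<close> as a signed permutation, and
  fixes or interchanges the spans of \<open>W2 = lk v2 - {v1}\<close> and \<open>W1 = lk v1 - {v2}\<close> accordingly.

  If M fixes a character of the quotient, the Reidemeister number is infinite.  Otherwise consider
  the sum over all permutations of \<open>W2 = {w_0, ..., w_n}\<close>, with signs, of the Lie elements
  \<open>[ad(v1)^a_0 w_0, [ad(v1)^a_1 w_1, ...]]\<close>.  In a suitable graded quotient \<open>\<phi>\<close> multiplies it by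
  \<open>\<plusminus> det (M on W2)\<close>, a sign that the parity of \<open>\<Sum>a_i\<close> can be used to correct (when v1 and v2 are
  interchanged, one adds its image under \<open>\<phi>\<close>).  This gives a nontrivial central element fixed by
  \<open>\<phi>\<close>.  The quotient is the one through which all unitriangular integer representations factor
  whose superdiagonal entries vanish on \<open>V - {v1, v2}\<close> outside \<open>|W2|\<close> given positions; reducing modulo
  q makes it finite.  In a finite group a fixed central subgroup of order m forces every twisted
  conjugacy class to have at most \<open>1/m\<close> of the elements, so there are at least m classes.
\<close>


section \<open>Upper triangular integer matrices\<close>

text \<open>Infinite matrices avoid a dimension parameter: representations of class c are read off from
  the entries with indices at most c.\<close>
typedef tri = "{f :: nat \<Rightarrow> nat \<Rightarrow> int. \<forall>i j. j < i \<longrightarrow> f i j = 0}"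
  morphisms ent Tri
  by (rule exI[of _ "\<lambda>_ _. 0"]) simp

setup_lifting type_definition_tri

lemma ent_below: "j < i \<Longrightarrow> ent A i j = 0"
  using ent[of A] by simp

lemma tri_eqI: "(\<And>i j. i \<le> j \<Longrightarrow> ent A i j = ent B i j) \<Longrightarrow> A = B"
  by (metis ent_below ent_inject ext linorder_not_less)

instantiation tri :: ring_1
begin

lift_definition zero_tri :: tri is "\<lambda>_ _. 0" by simp
lift_definition one_tri :: tri is "\<lambda>i j. if i = j then 1 else 0" by simp
lift_definition plus_tri :: "tri \<Rightarrow> tri \<Rightarrow> tri" is "\<lambda>f g i j. f i j + g i j" by simp
lift_definition minus_tri :: "tri \<Rightarrow> tri \<Rightarrow> tri" is "\<lambda>f g i j. f i j - g i j" by simp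
lift_definition uminus_tri :: "tri \<Rightarrow> tri" is "\<lambda>f i j. - f i j" by simp
lift_definition times_tri :: "tri \<Rightarrow> tri \<Rightarrow> tri" is "\<lambda>f g i j. \<Sum>l\<le>j. f i l * g l j"
  by (auto intro!: sum.neutral)

instance
proof
  fix a b c :: tri
  show "a * b * c = a * (b * c)"
  proof (rule tri_eqI)
    fix i j :: nat
    have "ent (a * b * c) i j = (\<Sum>l\<le>j. \<Sum>q\<le>l. ent a i q * ent b q l * ent c l j)"
      by (simp add: times_tri.rep_eq sum_distrib_right)
    also have "\<dots> = (\<Sum>l\<le>j. \<Sum>q\<le>j. ent a i q * ent b q l * ent c l j)"
      by (intro sum.cong refl sum.mono_neutral_left) (auto simp: ent_below)
    also have "\<dots> = (\<Sum>q\<le>j. \<Sum>l\<le>j. ent a i q * ent b q l * ent c l j)"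
      by (rule sum.swap)
    also have "\<dots> = ent (a * (b * c)) i j"
      by (simp add: times_tri.rep_eq sum_distrib_left mult.assoc)
    finally show "ent (a * b * c) i j = ent (a * (b * c)) i j" .
  qed
  show "1 * a = a"
    by (rule tri_eqI)
      (simp add: times_tri.rep_eq one_tri.rep_eq if_distrib[of "\<lambda>x. x * _"] cong: if_cong)
  show "a * 1 = a"
    by (rule tri_eqI) (simp add: times_tri.rep_eq one_tri.rep_eq if_distrib cong: if_cong)
  show "(a + b) * c = a * c + b * c"
    by (rule tri_eqI) (simp add: times_tri.rep_eq plus_tri.rep_eq distrib_right sum.distrib)
  show "a * (b + c) = a * b + a * c"
    by (rule tri_eqI) (simp add: times_tri.rep_eq plus_tri.rep_eq distrib_left sum.distrib)
  show "(0::tri) \<noteq> 1"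
    by (metis one_tri.rep_eq zero_neq_one zero_tri.rep_eq)
qed (rule tri_eqI; simp add: plus_tri.rep_eq minus_tri.rep_eq uminus_tri.rep_eq zero_tri.rep_eq)+

end

lemmas ent_simps [simp] = zero_tri.rep_eq one_tri.rep_eq plus_tri.rep_eq minus_tri.rep_eq
  uminus_tri.rep_eq

text \<open>The powers of the ideal of strictly upper triangular matrices.\<close>
definition depth_ge :: "nat \<Rightarrow> tri \<Rightarrow> bool" where
  "depth_ge n A \<longleftrightarrow> (\<forall>i j. j < i + n \<longrightarrow> ent A i j = 0)"

lemma depth_geD: "depth_ge n A \<Longrightarrow> j < i + n \<Longrightarrow> ent A i j = 0"
  by (simp add: depth_ge_def)

lemma depth_ge_mono: "depth_ge n A \<Longrightarrow> m \<le> n \<Longrightarrow> depth_ge m A"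
  by (simp add: depth_ge_def)

lemma depth_ge_zero [simp]: "depth_ge n 0"
  by (simp add: depth_ge_def)

lemma depth_ge_add: "depth_ge n A \<Longrightarrow> depth_ge n B \<Longrightarrow> depth_ge n (A + B)"
  by (simp add: depth_ge_def)

lemma depth_ge_diff: "depth_ge n A \<Longrightarrow> depth_ge n B \<Longrightarrow> depth_ge n (A - B)"
  by (simp add: depth_ge_def)

lemma depth_ge_mult:
  assumes "depth_ge m A" "depth_ge n B"
  shows "depth_ge (m + n) (A * B)"
  unfolding depth_ge_def
proof (intro allI impI)
  fix i j assume j: "j < i + (m + n)"
  have "ent A i l * ent B l j = 0" for l
    using depth_geD[OF assms(1), of l i] depth_geD[OF assms(2), of j l] j by (cases "l < i + m") auto
  then show "ent (A * B) i j = 0"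
    unfolding times_tri.rep_eq by (intro sum.neutral) blast
qed

text \<open>In the sum over l, the factor from A vanishes for l < i + m and the factor from B for l
  > i + m, so a single product is left.\<close>

lemma ent_mult_lead:
  assumes "depth_ge m A" "depth_ge n B"
  shows "ent (A * B) i (i + m + n) = ent A i (i + m) * ent B (i + m) (i + m + n)"
proof -
  have "ent A i l * ent B l (i + m + n) = 0" if "l \<noteq> i + m" for l
    using depth_geD[OF assms(1), of l i] depth_geD[OF assms(2), of "i + m + n" l] that
    by (cases "l < i + m") auto
  then have "ent (A * B) i (i + m + n)
    = (\<Sum>l\<in>{i + m}. ent A i l * ent B l (i + m + n))"
    unfolding times_tri.rep_eq by (intro sum.mono_neutral_right) auto
  then show ?thesis by simp
qed

lift_definition superdiag :: "(nat \<Rightarrow> int) \<Rightarrow> tri" is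
  "\<lambda>f i j. if j = Suc i then f i else 0" by simp

text \<open>The Neumann series of \<open>1 + superdiag f\<close>: only the (j - i)-th power of the
  negated superdiagonal matrix reaches the entry (i, j), where it is this product.\<close>

lift_definition superdiag_inv :: "(nat \<Rightarrow> int) \<Rightarrow> tri" is
  "\<lambda>f i j. if i \<le> j then \<Prod>q = i..<j. - f q else 0" by simp

lemma ent_superdiag_mult: "ent (superdiag f * A) i j = f i * ent A (Suc i) j"
  by (auto simp: times_tri.rep_eq superdiag.rep_eq if_distrib[of "\<lambda>x. x * _"] ent_below
      cong: if_cong)

lemma ent_mult_superdiag: "ent (A * superdiag f) i (Suc j) = ent A i j * f j"
  "ent (A * superdiag f) i 0 = 0"
  by (simp_all add: times_tri.rep_eq superdiag.rep_eq if_distrib[of "\<lambda>x. _ * x"] cong: if_cong)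

lemma superdiag_inv_right: "(1 + superdiag f) * superdiag_inv f = 1"
proof (rule tri_eqI)
  fix i j :: nat assume "i \<le> j"
  then show "ent ((1 + superdiag f) * superdiag_inv f) i j = ent 1 i j"
    by (cases "i = j")
      (auto simp: distrib_right ent_superdiag_mult superdiag_inv.rep_eq prod.atLeast_Suc_lessThan)
qed

lemma superdiag_inv_left: "superdiag_inv f * (1 + superdiag f) = 1"
proof (rule tri_eqI)
  fix i j :: nat assume "i \<le> j"
  then show "ent (superdiag_inv f * (1 + superdiag f)) i j = ent 1 i j"
    by (cases j)
      (auto simp: distrib_left ent_mult_superdiag superdiag_inv.rep_eq prod.atLeastLessThan_Suc
       le_Suc_eq)
qed

lemma superdiag_commute:
  assumes "\<And>p. f p * g (Suc p) = g p * f (Suc p)"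
  shows "superdiag f * superdiag g = superdiag g * superdiag f"
  by (rule tri_eqI) (auto simp: ent_superdiag_mult superdiag.rep_eq assms)

section \<open>Unipotent representations\<close>

definition additive_on :: "('a, 'b) monoid_scheme \<Rightarrow> ('a \<Rightarrow> int) \<Rightarrow> bool" where
  "additive_on A \<chi> \<longleftrightarrow> (\<forall>g \<in> carrier A. \<forall>h \<in> carrier A. \<chi> (g \<otimes>\<^bsub>A\<^esub> h) = \<chi> g + \<chi> h)"

lemma additive_onD:
  "additive_on A \<chi> \<Longrightarrow> g \<in> carrier A \<Longrightarrow> h \<in> carrier A \<Longrightarrow> \<chi> (g \<otimes>\<^bsub>A\<^esub> h) = \<chi> g + \<chi> h"
  by (simp add: additive_on_def)

lemma (in group) additive_on_one: "additive_on G \<chi> \<Longrightarrow> \<chi> \<one> = 0"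
  using additive_onD[of G \<chi> \<one> \<one>] by simp

lemma (in group) additive_on_inv: "additive_on G \<chi> \<Longrightarrow> g \<in> carrier G \<Longrightarrow> \<chi> (inv g) = - \<chi> g"
  using additive_onD[of G \<chi> "inv g" g] by (simp add: additive_on_one)

definition unirep :: "('a, 'b) monoid_scheme \<Rightarrow> ('a \<Rightarrow> tri) \<Rightarrow> bool" where
  "unirep A \<rho> \<longleftrightarrow> \<rho> \<one>\<^bsub>A\<^esub> = 1 \<and>
     (\<forall>g \<in> carrier A. \<forall>h \<in> carrier A. \<rho> (g \<otimes>\<^bsub>A\<^esub> h) = \<rho> g * \<rho> h) \<and>
     (\<forall>g \<in> carrier A. depth_ge 1 (\<rho> g - 1))"

lemma unirepD:
  assumes "unirep A \<rho>"
  shows "\<rho> \<one>\<^bsub>A\<^esub> = 1"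
    and "g \<in> carrier A \<Longrightarrow> h \<in> carrier A \<Longrightarrow> \<rho> (g \<otimes>\<^bsub>A\<^esub> h) = \<rho> g * \<rho> h"
    and "g \<in> carrier A \<Longrightarrow> depth_ge 1 (\<rho> g - 1)"
  using assms by (auto simp: unirep_def)

text \<open>The failure of additivity is \<open>(\<rho> g - 1) * (\<rho> h - 1)\<close>, which has
  depth 2 and does not reach the first superdiagonal.\<close>

lemma additive_on_ent:
  assumes "unirep A \<rho>"
  shows "additive_on A (\<lambda>g. ent (\<rho> g) p (Suc p))"
  unfolding additive_on_def
proof (intro ballI)
  fix g h assume g: "g \<in> carrier A" and h: "h \<in> carrier A"
  note d = unirepD(3)[OF assms g] unirepD(3)[OF assms h]
  have "ent ((\<rho> g - 1) * (\<rho> h - 1)) p (Suc p) = 0"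
    using depth_geD[OF depth_ge_mult[OF d], of "Suc p" p] by simp
  moreover have "\<rho> (g \<otimes>\<^bsub>A\<^esub> h) = \<rho> g + \<rho> h - 1 + (\<rho> g - 1) * (\<rho> h - 1)"
    by (simp add: unirepD(2)[OF assms g h] algebra_simps)
  ultimately show "ent (\<rho> (g \<otimes>\<^bsub>A\<^esub> h)) p (Suc p) = ent (\<rho> g) p (Suc p) + ent (\<rho> h) p (Suc p)"
    by simp
qed

text \<open>The correction \<open>(\<rho> g - 1) * (\<rho> h - 1)\<close> has depth 2c > c. On
  elements of depth c the corner entry (0, c) thus behaves like a character.\<close>

lemma (in group) unirep_mult_lead:
  assumes \<rho>: "unirep G \<rho>" and c: "c > 0" and g: "g \<in> carrier G" "depth_ge c (\<rho> g - 1)"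
    and h: "h \<in> carrier G" "depth_ge c (\<rho> h - 1)"
  shows "depth_ge c (\<rho> (g \<otimes> h) - 1)" and "ent (\<rho> (g \<otimes> h)) 0 c = ent (\<rho> g) 0 c + ent (\<rho> h) 0 c"
proof -
  have eq: "\<rho> (g \<otimes> h) - 1 = (\<rho> g - 1) + (\<rho> h - 1) + (\<rho> g - 1) * (\<rho> h - 1)"
    using unirepD(2)[OF \<rho> g(1) h(1)] by (simp add: algebra_simps)
  note d = depth_ge_mult[OF g(2) h(2)]
  show "depth_ge c (\<rho> (g \<otimes> h) - 1)"
    unfolding eq using g h depth_ge_mono[OF d, of c] by (simp add: depth_ge_add)
  show "ent (\<rho> (g \<otimes> h)) 0 c = ent (\<rho> g) 0 c + ent (\<rho> h) 0 c"
    using arg_cong[OF eq, of "\<lambda>T. ent T 0 c"] depth_geD[OF d, of c 0] c by simp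
qed

section \<open>Elements, generators and representations of the right-angled Artin group\<close>

definition raag_class :: "'v pair_pre_digraph \<Rightarrow> 'v word \<Rightarrow> 'v word set" where
  "raag_class G u = pres_rel (pverts G) {commutator_word v w | v w. (v, w) \<in> parcs G} `` {u}"

abbreviation gen :: "'v pair_pre_digraph \<Rightarrow> 'v \<Rightarrow> 'v word set" where
  "gen G v \<equiv> raag_class G [(v, True)]"

lemma group_raag: "group (raag G)"
  by (simp add: raag_def group_presented_group)

lemma raag_one: "\<one>\<^bsub>raag G\<^esub> = raag_class G []"
  by (simp add: raag_def presented_group_def raag_class_def)

lemma raag_carrier: "g \<in> carrier (raag G) \<longleftrightarrow> (\<exists>u \<in> words (pverts G). g = raag_class G u)"
  by (auto simp: raag_def presented_group_def quotient_def raag_class_def)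

lemma raag_class_closed: "u \<in> words (pverts G) \<Longrightarrow> raag_class G u \<in> carrier (raag G)"
  by (auto simp: raag_carrier)

lemma raag_mult:
  "u \<in> words (pverts G) \<Longrightarrow> w \<in> words (pverts G) \<Longrightarrow>
    raag_class G u \<otimes>\<^bsub>raag G\<^esub> raag_class G w = raag_class G (u @ w)"
  by (simp add: raag_def raag_class_def presented_group_mult_class)

lemma raag_class_eqI:
  "pres_eq (pverts G) {commutator_word v w | v w. (v, w) \<in> parcs G} u u' \<Longrightarrow>
    raag_class G u = raag_class G u'"
  unfolding raag_class_def by (rule equiv_class_eq[OF equiv_pres_rel]) (simp add: pres_rel_def)

lemma inv_gen:
  assumes "v \<in> pverts G"
  shows "inv\<^bsub>raag G\<^esub> (gen G v) = raag_class G [(v, False)]"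
proof -
  interpret group "raag G" by (rule group_raag)
  have "raag_class G [(v, False)] \<otimes>\<^bsub>raag G\<^esub> gen G v = \<one>\<^bsub>raag G\<^esub>"
    using assms pres_eq.cancel[of v "pverts G" _ False]
    by (simp add: raag_mult raag_one raag_class_eqI)
  then show ?thesis
    using assms by (intro inv_equality) (auto intro: raag_class_closed)
qed

lemma raag_induct [consumes 1, case_names one gen inv_gen]:
  assumes "g \<in> carrier (raag G)"
    and "P \<one>\<^bsub>raag G\<^esub>"
    and "\<And>v g. v \<in> pverts G \<Longrightarrow> g \<in> carrier (raag G) \<Longrightarrow> P g \<Longrightarrow> P (gen G v \<otimes>\<^bsub>raag G\<^esub> g)"
    and "\<And>v g. v \<in> pverts G \<Longrightarrow> g \<in> carrier (raag G) \<Longrightarrow> P g \<Longrightarrow>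
      P (inv\<^bsub>raag G\<^esub> (gen G v) \<otimes>\<^bsub>raag G\<^esub> g)"
  shows "P g"
proof -
  have "P (raag_class G u)" if "u \<in> words (pverts G)" for u
    using that
  proof (induction u)
    case Nil
    then show ?case using assms(2) by (simp add: raag_one)
  next
    case (Cons x u)
    then obtain v e where x: "x = (v, e)" "v \<in> pverts G" and u: "u \<in> words (pverts G)"
      by (cases x) auto
    have "raag_class G (x # u) = raag_class G [x] \<otimes>\<^bsub>raag G\<^esub> raag_class G u"
      using x u by (subst raag_mult) auto
    then show ?case
      using assms(3,4)[OF x(2) raag_class_closed[OF u] Cons.IH[OF u]]
      by (cases e) (auto simp: x inv_gen)
  qed
  then show ?thesis using assms(1) by (auto simp: raag_carrier)
qed

lemma gen_commute:
  assumes "pair_graph G" "(v, w) \<in> parcs G"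
  shows "gen G v \<otimes>\<^bsub>raag G\<^esub> gen G w = gen G w \<otimes>\<^bsub>raag G\<^esub> gen G v"
proof -
  interpret pair_graph G by fact
  interpret group "raag G" by (rule group_raag)
  have vw: "v \<in> pverts G" "w \<in> pverts G"
    using wellformed'[OF assms(2)] by simp_all
  let ?g = "gen G v" and ?h = "gen G w"
  have cl: "?g \<in> carrier (raag G)" "?h \<in> carrier (raag G)"
    using vw by (auto intro: raag_class_closed)
  have "pres_eq (pverts G) {commutator_word v w | v w. (v, w) \<in> parcs G} (commutator_word v w) []"
    using assms(2) vw by (intro pres_eq.relator) (auto simp: commutator_word_def)
  then have "raag_class G (commutator_word v w) = \<one>\<^bsub>raag G\<^esub>"
    by (simp add: raag_class_eqI raag_one)
  moreover have "raag_class G (commutator_word v w)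
    = ?g \<otimes>\<^bsub>raag G\<^esub> ?h \<otimes>\<^bsub>raag G\<^esub> inv\<^bsub>raag G\<^esub> ?g \<otimes>\<^bsub>raag G\<^esub> inv\<^bsub>raag G\<^esub> ?h"
    using vw by (simp add: inv_gen raag_mult commutator_word_def)
  ultimately have "?g \<otimes>\<^bsub>raag G\<^esub> ?h \<otimes>\<^bsub>raag G\<^esub> inv\<^bsub>raag G\<^esub> ?g = ?h"
    using cl by (metis inv_closed inv_equality inv_inv m_closed)
  then show ?thesis
    using cl by (metis inv_closed inv_solve_right m_closed)
qed

text \<open>Words are evaluated as products of matrices. Relators evaluate to 1 because the
  hypothesis makes the matrices of adjacent vertices commute. All explicit representations below
  arise in this way.\<close>

lemma unirep_from_superdiag:
  fixes f :: "'v \<Rightarrow> nat \<Rightarrow> int"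
  assumes "\<And>v w p. (v, w) \<in> parcs G \<Longrightarrow> f v p * f w (Suc p) = f w p * f v (Suc p)"
  shows "\<exists>\<rho>. unirep (raag G) \<rho> \<and> (\<forall>v \<in> pverts G. \<rho> (gen G v) = 1 + superdiag (f v))"
proof -
  let ?R = "{commutator_word v w | v w. (v, w) \<in> parcs G}"
  define letter where "letter x = (if snd x then 1 + superdiag (f (fst x)) else superdiag_inv (f (fst x)))"
    for x :: "'v \<times> bool"
  define val where "val u = prod_list (map letter u)" for u
  have cancel: "letter (v, e) * letter (v, \<not> e) = 1" for v e
    by (cases e) (simp_all add: letter_def superdiag_inv_left superdiag_inv_right)
  have val_app: "val (u @ w) = val u * val w" for u w
    by (simp add: val_def)
  have val_eq: "val u = val u'" if "pres_eq (pverts G) ?R u u'" for u u'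
    using that
  proof (induction rule: pres_eq.induct)
    case (cancel s e)
    then show ?case using \<open>\<And>v e. letter (v, e) * letter (v, \<not> e) = 1\<close> by (simp add: val_def)
  next
    case (relator r)
    then obtain v w where vw: "(v, w) \<in> parcs G" "r = commutator_word v w" by auto
    let ?v = "letter (v, True)" and ?w = "letter (w, True)"
    have "?v * ?w = ?w * ?v"
      using superdiag_commute[of "f v" "f w"] assms[OF vw(1)] by (simp add: letter_def algebra_simps)
    then have "?v * ?w * letter (v, False) * letter (w, False)
      = ?w * (?v * letter (v, False)) * letter (w, False)"
      by (simp add: mult.assoc)
    also have "\<dots> = 1"
      using cancel[of v True] cancel[of w True] by simp
    finally show ?case
      by (simp add: vw(2) val_def commutator_word_def mult.assoc)
  qed (simp_all add: val_app)
  \<comment> \<open>A group element is a class of words; \<open>val\<close> is constant on it, so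
    the choice of a representative is harmless.\<close>
  define \<rho> where "\<rho> g = val (SOME u. u \<in> g)" for g
  have \<rho>: "\<rho> (raag_class G u) = val u" if "u \<in> words (pverts G)" for u
  proof -
    have "u \<in> raag_class G u"
      using that by (auto simp: raag_class_def pres_rel_def intro: pres_eq.refl)
    then have "(SOME u'. u' \<in> raag_class G u) \<in> raag_class G u"
      by (rule someI)
    then show ?thesis
      using val_eq by (auto simp: \<rho>_def raag_class_def pres_rel_def)
  qed
  have letter_depth: "depth_ge 1 (letter x - 1)" for x
    by (auto simp: letter_def depth_ge_def superdiag.rep_eq superdiag_inv.rep_eq)
  have val_depth: "depth_ge 1 (val u - 1)" for u
  proof (induction u)
    case Nil
    then show ?case by (simp add: val_def)
  next
    case (Cons x u)
    have "val (x # u) - 1 = (letter x - 1) + (val u - 1) + (letter x - 1) * (val u - 1)"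
      by (simp add: val_def algebra_simps)
    moreover have "depth_ge 1 ((letter x - 1) * (val u - 1))"
      using depth_ge_mono[OF depth_ge_mult[OF letter_depth Cons.IH]] by simp
    ultimately show ?case
      using letter_depth Cons.IH by (metis depth_ge_add)
  qed
  have "unirep (raag G) \<rho>"
    unfolding unirep_def using val_depth
    by (auto simp: raag_carrier raag_one raag_mult \<rho> val_app simp del: One_nat_def)
      (simp add: val_def)
  moreover have "\<rho> (gen G v) = 1 + superdiag (f v)" if "v \<in> pverts G" for v
    using that by (simp add: \<rho> val_def letter_def)
  ultimately show ?thesis by blast
qed

section \<open>Counting twisted conjugacy classes\<close>

text \<open>\<open>E\<close> plays the quotient map onto a finite group: equality under
  \<open>E\<close> is a congruence preserved by \<phi>. There y becomes a fixed central element with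
  m distinct powers. The twisted orbit map is constant on cosets of these powers, so a twisted class
  fills at most 1/m of the quotient.\<close>

lemma (in group) reidemeister_number_ge:
  assumes phi: "\<phi> \<in> hom G G"
    and fin: "finite (E ` carrier G)"
    and mult: "\<And>g g' h h'. g \<in> carrier G \<Longrightarrow> g' \<in> carrier G \<Longrightarrow> h \<in> carrier G \<Longrightarrow> h' \<in> carrier G \<Longrightarrow>
      E g = E g' \<Longrightarrow> E h = E h' \<Longrightarrow> E (g \<otimes> h) = E (g' \<otimes> h')"
    and E_phi: "\<And>g g'. g \<in> carrier G \<Longrightarrow> g' \<in> carrier G \<Longrightarrow> E g = E g' \<Longrightarrow> E (\<phi> g) = E (\<phi> g')"
    and y: "y \<in> carrier G" and central: "\<And>g. g \<in> carrier G \<Longrightarrow> E (y \<otimes> g) = E (g \<otimes> y)"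
    and fixed: "E (\<phi> y) = E y"
    and inj: "inj_on (\<lambda>t::nat. E (y [^] t)) {..<m}"
  shows "enat m \<le> reidemeister_number G \<phi>"
proof -
  let ?C = "carrier G // twisted_conj G \<phi>" and ?S = "E ` carrier G"
  have phi_cl [simp]: "\<phi> g \<in> carrier G" if "g \<in> carrier G" for g
    using phi that by (auto simp: hom_def)
  have E_inv: "E (inv a) = E (inv b)" if "a \<in> carrier G" "b \<in> carrier G" "E a = E b" for a b
  proof -
    have "E (inv a \<otimes> b) = E (inv a \<otimes> a)"
      using that by (intro mult) auto
    then have "E ((inv a \<otimes> b) \<otimes> inv b) = E (\<one> \<otimes> inv b)"
      using that by (intro mult) auto
    then show ?thesis
      using that by (simp add: m_assoc)
  qed
  have card_class: "card (E ` c) * m \<le> card ?S" if "c \<in> ?C" for c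
  proof -
    from that obtain x where x: "x \<in> carrier G" and c: "c = twisted_conj G \<phi> `` {x}"
      by (auto simp: quotient_def)
    \<comment> \<open>The twisted orbit map of x, read in the quotient; its image contains that of
      the class c.\<close>
    define F where "F h = E (h \<otimes> x \<otimes> inv (\<phi> h))" for h
    have F_y: "F (h \<otimes> y) = F h" if h: "h \<in> carrier G" for h
    proof -
      \<comment> \<open>In the quotient y commutes with x and equals \<phi>(y), so the two new
        factors cancel.\<close>
      have "E (h \<otimes> (y \<otimes> x) \<otimes> inv (\<phi> y) \<otimes> inv (\<phi> h)) = E (h \<otimes> (x \<otimes> y) \<otimes> inv y \<otimes> inv (\<phi> h))"
        using h x y by (intro mult HOL.refl central E_inv fixed) auto
      also have "h \<otimes> (x \<otimes> y) \<otimes> inv y \<otimes> inv (\<phi> h) = h \<otimes> x \<otimes> inv (\<phi> h)"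
        using h x y by (simp add: m_assoc inv_solve_right)
      finally show ?thesis
        using h x y hom_mult[OF phi h y] by (simp add: F_def m_assoc inv_mult_group)
    qed
    have F_pow: "F (h \<otimes> y [^] t) = F h" if h: "h \<in> carrier G" for h and t :: nat
    proof (induction t)
      case 0
      then show ?case using h by simp
    next
      case (Suc t)
      then show ?case using F_y[of "h \<otimes> y [^] t"] h y by (simp add: m_assoc)
    qed
    have F_cong: "F h = F h'" if "h \<in> carrier G" "h' \<in> carrier G" "E h = E h'" for h h'
      unfolding F_def using that x by (intro mult E_inv E_phi) auto
    have "E ` c \<subseteq> F ` carrier G"
    proof
      fix s assume "s \<in> E ` c"
      then obtain z g where zg: "z \<in> carrier G" "g \<in> carrier G" "s = E z" "x = g \<otimes> z \<otimes> inv (\<phi> g)"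
        by (auto simp: c twisted_conj_def)
      have "\<phi> (inv g) = inv (\<phi> g)"
        using zg phi group_hom.hom_inv[of G G \<phi> g] group_hom.intro[OF is_group is_group]
        by (simp add: group_hom_axioms_def)
      moreover have "inv g \<otimes> x \<otimes> \<phi> g = (inv g \<otimes> g) \<otimes> z \<otimes> (inv (\<phi> g) \<otimes> \<phi> g)"
        using zg by (simp only: m_assoc m_closed inv_closed phi_cl)
      ultimately have "z = inv g \<otimes> x \<otimes> inv (\<phi> (inv g))"
        using zg by simp
      then show "s \<in> F ` carrier G"
        using zg by (auto simp: F_def intro!: image_eqI[of _ _ "inv g"])
    qed
    then have "\<forall>s \<in> E ` c. \<exists>h \<in> carrier G. F h = s"
      by (auto simp: image_subset_iff) (metis imageE)
    then obtain r where r: "\<And>s. s \<in> E ` c \<Longrightarrow> r s \<in> carrier G" "\<And>s. s \<in> E ` c \<Longrightarrow> F (r s) = s"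
      by metis
    \<comment> \<open>\<open>F\<close> recovers s from \<open>r s\<close> times y^t; cancelling
      \<open>r s\<close> then recovers t < m.\<close>
    have "inj_on (\<lambda>(s, t). E (r s \<otimes> y [^] t)) ((E ` c) \<times> {..<m})"
    proof (rule inj_onI, clarify)
      fix a b t t'
      let ?s = "E a" and ?s' = "E b"
      assume s: "a \<in> c" "b \<in> c" and t: "t < m" "t' < m"
        and eq: "E (r ?s \<otimes> y [^] t) = E (r ?s' \<otimes> y [^] t')"
      have rs: "r ?s \<in> carrier G" "r ?s' \<in> carrier G"
        using r s by auto
      have "F (r ?s) = F (r ?s')"
        using F_cong[OF _ _ eq] F_pow rs y by simp
      then have ss: "?s = ?s'"
        using r s by auto
      have "E (inv (r ?s) \<otimes> (r ?s \<otimes> y [^] t)) = E (inv (r ?s) \<otimes> (r ?s \<otimes> y [^] t'))"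
        by (rule mult) (use eq rs y ss in auto)
      moreover have "inv (r ?s) \<otimes> (r ?s \<otimes> z) = z" if "z \<in> carrier G" for z
        using rs that by (simp add: m_assoc[symmetric])
      ultimately have "E (y [^] t) = E (y [^] t')"
        using y by (metis nat_pow_closed)
      then show "?s = ?s' \<and> t = t'"
        using inj t ss by (auto dest: inj_onD)
    qed
    moreover have "(\<lambda>(s, t). E (r s \<otimes> y [^] t)) ` ((E ` c) \<times> {..<m}) \<subseteq> ?S"
      using r(1) y by force
    ultimately have "card ((E ` c) \<times> {..<m}) \<le> card ?S"
      by (rule card_inj_on_le) (rule fin)
    then show ?thesis
      by (simp add: card_cartesian_product)
  qed
  have "m \<le> card ?C" if finC: "finite ?C"
  proof -
    have "?S \<subseteq> (\<Union>c \<in> ?C. E ` c)"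
    proof
      fix s assume "s \<in> ?S"
      then obtain x where x: "x \<in> carrier G" "s = E x" by auto
      have "(x, x) \<in> twisted_conj G \<phi>"
        using x hom_one[OF phi is_group] by (auto simp: twisted_conj_def intro!: bexI[of _ \<one>])
      then show "s \<in> (\<Union>c \<in> ?C. E ` c)"
        using x by (auto simp: quotient_def)
    qed
    moreover have "(\<Union>c \<in> ?C. E ` c) \<subseteq> ?S"
      by (auto simp: quotient_def twisted_conj_def)
    ultimately have "card ?S \<le> (\<Sum>c \<in> ?C. card (E ` c))"
      using card_UN_le[OF finC, of "\<lambda>c. E ` c"] by (metis subset_antisym)
    then have "card ?S * m \<le> (\<Sum>c \<in> ?C. card (E ` c) * m)"
      by (simp add: sum_distrib_right[symmetric])
    also have "\<dots> \<le> (\<Sum>c \<in> ?C. card ?S)"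
      by (intro sum_mono card_class)
    finally have "card ?S * m \<le> card ?S * card ?C"
      by (simp add: mult.commute)
    moreover have "card ?S > 0"
      using fin by (auto simp: card_gt_0_iff)
    ultimately show ?thesis by simp
  qed
  then show ?thesis
    by (auto simp: reidemeister_number_def Let_def)
qed

text \<open>Invariance of \<chi> makes it constant on each twisted conjugacy class, while on the
  powers of y it takes infinitely many values.\<close>

lemma (in group) reidemeister_number_additive:
  assumes phi: "\<phi> \<in> hom G G" and add: "additive_on G \<chi>"
    and inv: "\<And>g. g \<in> carrier G \<Longrightarrow> \<chi> (\<phi> g) = \<chi> g"
    and y: "y \<in> carrier G" "\<chi> y \<noteq> 0"
  shows "reidemeister_number G \<phi> = \<infinity>"
proof -
  let ?C = "carrier G // twisted_conj G \<phi>"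
  have phi_cl [simp]: "\<phi> g \<in> carrier G" if "g \<in> carrier G" for g
    using phi that by (auto simp: hom_def)
  have const: "\<chi> ` c \<subseteq> {\<chi> (SOME z. z \<in> c)}" if "c \<in> ?C" for c
  proof -
    from that obtain x where x: "x \<in> carrier G" and c: "c = twisted_conj G \<phi> `` {x}"
      by (auto simp: quotient_def)
    have "\<chi> z = \<chi> x" if "z \<in> c" for z
    proof -
      from that obtain g where g: "z \<in> carrier G" "g \<in> carrier G" "x = g \<otimes> z \<otimes> inv (\<phi> g)"
        by (auto simp: c twisted_conj_def)
      then show ?thesis
        by (simp add: additive_onD[OF add] additive_on_inv[OF add] inv)
    qed
    then show ?thesis by (metis image_subsetI singletonI someI)
  qed
  have "infinite ?C"
  proof
    assume fin: "finite ?C"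
    have "\<chi> ` carrier G \<subseteq> (\<lambda>c. \<chi> (SOME z. z \<in> c)) ` ?C"
    proof
      fix s assume "s \<in> \<chi> ` carrier G"
      then obtain x where x: "x \<in> carrier G" "s = \<chi> x" by auto
      have "(x, x) \<in> twisted_conj G \<phi>"
        using x hom_one[OF phi is_group] by (auto simp: twisted_conj_def intro!: bexI[of _ \<one>])
      then have "x \<in> twisted_conj G \<phi> `` {x}" "twisted_conj G \<phi> `` {x} \<in> ?C"
        using x by (auto simp: quotient_def)
      then show "s \<in> (\<lambda>c. \<chi> (SOME z. z \<in> c)) ` ?C"
        using const x(2) by blast
    qed
    then have "finite (\<chi> ` carrier G)"
      using fin finite_surj by blast
    moreover have "\<chi> (y [^] t) = int t * \<chi> y" for t :: nat
      using y(1) by (induction t) (auto simp: additive_onD[OF add] additive_on_one[OF add] algebra_simps)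
    then have "inj (\<lambda>t::nat. \<chi> (y [^] t))"
      using y(2) by (intro injI) simp
    ultimately show False
      using y(1) finite_subset[of "range (\<lambda>t::nat. \<chi> (y [^] t))" "\<chi> ` carrier G"]
        range_inj_infinite[of "\<lambda>t::nat. \<chi> (y [^] t)"] by auto
  qed
  then show ?thesis
    by (simp add: reidemeister_number_def)
qed

section \<open>Finite quotients by truncation modulo q\<close>

definition trunc :: "int \<Rightarrow> nat \<Rightarrow> tri \<Rightarrow> nat \<times> nat \<Rightarrow> int" where
  "trunc q c T = restrict (\<lambda>(i, j). ent T i j mod q) ({..c} \<times> {..c})"

lemma trunc_eq_iff:
  "trunc q c T = trunc q c T' \<longleftrightarrow> (\<forall>i \<le> c. \<forall>j \<le> c. ent T i j mod q = ent T' i j mod q)"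
  by (auto simp: trunc_def fun_eq_iff restrict_def)

lemma trunc_mult_cong:
  assumes "trunc q c S = trunc q c S'" "trunc q c T = trunc q c T'"
  shows "trunc q c (S * T) = trunc q c (S' * T')"
  unfolding trunc_eq_iff
proof (intro allI impI)
  fix i j assume ij: "i \<le> c" "j \<le> c"
  have "ent S i l * ent T l j mod q = ent S' i l * ent T' l j mod q" if "l \<le> j" for l
    using assms that ij by (auto simp: trunc_eq_iff intro!: mod_mult_cong)
  then have "(\<Sum>l\<le>j. ent S i l * ent T l j) mod q = (\<Sum>l\<le>j. ent S' i l * ent T' l j) mod q"
    by (metis (mono_tags, lifting) atMost_iff mod_sum_eq sum.cong)
  then show "ent (S * T) i j mod q = ent (S' * T') i j mod q"
    by (simp add: times_tri.rep_eq)
qed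

text \<open>Because of \<open>restrict\<close> the values are extensional functions from a finite
  square into {0..<q}, hence members of a finite product.\<close>

lemma finite_range_trunc: "q > 0 \<Longrightarrow> finite (range (trunc q c))"
  by (rule finite_subset[of _ "({..c} \<times> {..c}) \<rightarrow>\<^sub>E {0..<q}"])
    (auto simp: trunc_def intro!: finite_PiE)

lemma finite_PiE_range_trunc: "finite S \<Longrightarrow> q > 0 \<Longrightarrow> finite (S \<rightarrow>\<^sub>E range (trunc q c))"
  using finite_PiE[of S "\<lambda>_. range (trunc q c)"] finite_range_trunc[of q c] by simp

text \<open>The family \<open>R\<close> may be infinite, but after truncation a representation is
  determined by its values on the finitely many generators and their inverses. So only finitely many
  truncated representations occur, each with finite range, and together they determine
  \<open>E\<close>.\<close>

lemma finite_trunc_classes: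
  fixes G :: "'v pair_pre_digraph" and c :: nat
  assumes fin: "finite (pverts G)" and q: "q > 0" and R: "\<And>\<rho>. \<rho> \<in> R \<Longrightarrow> unirep (raag G) \<rho>"
  defines "E \<equiv> \<lambda>g. {h \<in> carrier (raag G). \<forall>\<rho> \<in> R. trunc q c (\<rho> g) = trunc q c (\<rho> h)}"
  shows "finite (E ` carrier (raag G))"
proof -
  interpret group "raag G" by (rule group_raag)
  define L where "L = gen G ` pverts G \<union> (\<lambda>v. inv\<^bsub>raag G\<^esub> (gen G v)) ` pverts G"
  define D where "D \<rho> = restrict (\<lambda>x. trunc q c (\<rho> x)) L" for \<rho>
  have L: "finite L" using fin by (simp add: L_def)
  have gen_cl: "gen G v \<in> carrier (raag G)" if "v \<in> pverts G" for v
    using that by (auto intro: raag_class_closed)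
  have D_eq: "trunc q c (\<rho> g) = trunc q c (\<rho>' g)"
    if \<rho>: "\<rho> \<in> R" "\<rho>' \<in> R" and D: "D \<rho> = D \<rho>'" and "g \<in> carrier (raag G)" for \<rho> \<rho>' g
    using that(4)
  proof (induction g rule: raag_induct)
    case one
    then show ?case using R \<rho> by (simp add: unirepD)
  next
    case (gen v g)
    then have "trunc q c (\<rho> (gen G v)) = trunc q c (\<rho>' (gen G v))"
      using fun_cong[OF D, of "gen G v"] by (simp add: D_def L_def)
    then show ?case
      using gen \<rho> gen_cl by (auto simp: unirepD(2)[OF R] intro!: trunc_mult_cong)
  next
    case (inv_gen v g)
    then have "trunc q c (\<rho> (inv\<^bsub>raag G\<^esub> (gen G v))) = trunc q c (\<rho>' (inv\<^bsub>raag G\<^esub> (gen G v)))"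
      using fun_cong[OF D, of "inv\<^bsub>raag G\<^esub> (gen G v)"] by (simp add: D_def L_def)
    then show ?case
      using inv_gen \<rho> gen_cl by (auto simp: unirepD(2)[OF R] intro!: trunc_mult_cong)
  qed
  have "D ` R \<subseteq> L \<rightarrow>\<^sub>E range (trunc q c)"
    by (auto simp: D_def)
  then have fin_D: "finite (D ` R)"
    by (rule finite_subset) (simp add: finite_PiE_range_trunc L q)
  \<comment> \<open>One representation is kept for each table \<open>d\<close> of truncated values;
    the finite table \<open>K g\<close> then determines \<open>E g\<close>.\<close>
  define r where "r d = (SOME \<rho>. \<rho> \<in> R \<and> D \<rho> = d)" for d
  have r: "r d \<in> R \<and> D (r d) = d" if "d \<in> D ` R" for d
    unfolding r_def using that by (intro someI_ex[where P = "\<lambda>\<rho>. \<rho> \<in> R \<and> D \<rho> = d"]) auto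
  define K where "K g = restrict (\<lambda>d. trunc q c (r d g)) (D ` R)" for g
  have E_eq: "E g = E h" if g: "g \<in> carrier (raag G)" and h: "h \<in> carrier (raag G)" and K: "K g = K h" for g h
  proof -
    have "trunc q c (\<rho> g) = trunc q c (\<rho> h)" if "\<rho> \<in> R" for \<rho>
    proof -
      have "trunc q c (r (D \<rho>) g) = trunc q c (r (D \<rho>) h)"
        using fun_cong[OF K, of "D \<rho>"] that by (simp add: K_def)
      moreover have "trunc q c (r (D \<rho>) x) = trunc q c (\<rho> x)" if "x \<in> carrier (raag G)" for x
        using D_eq[of "r (D \<rho>)" \<rho> x] r[of "D \<rho>"] \<open>\<rho> \<in> R\<close> that by simp
      ultimately show ?thesis using g h by simp
    qed
    then show ?thesis by (auto simp: E_def)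
  qed
  have fin_K: "finite (K ` carrier (raag G))"
  proof (rule finite_subset)
    show "K ` carrier (raag G) \<subseteq> D ` R \<rightarrow>\<^sub>E range (trunc q c)"
      by (auto simp: K_def)
    show "finite (D ` R \<rightarrow>\<^sub>E range (trunc q c))"
      by (simp add: finite_PiE_range_trunc fin_D q)
  qed
  define f where "f k = (SOME g. g \<in> carrier (raag G) \<and> K g = k)" for k
  have f: "f (K g) \<in> carrier (raag G) \<and> K (f (K g)) = K g" if "g \<in> carrier (raag G)" for g
    unfolding f_def by (rule someI_ex) (use that in blast)
  have "E g = E (f (K g))" if g: "g \<in> carrier (raag G)" for g
    using E_eq[of g "f (K g)"] f[OF g] g by simp
  then have "E ` carrier (raag G) \<subseteq> E ` f ` K ` carrier (raag G)"
    by blast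
  then show ?thesis
    by (rule finite_subset) (simp add: fin_K)
qed

text \<open>The finite quotient identifies elements with equal truncations in all members of
  \<open>R\<close>; stability of \<open>R\<close> under \<phi> makes \<phi> descend to it. Depth c
  makes y central there and leaves the corner (0, c) as the only entry that \<phi> could
  change.\<close>

lemma reidemeister_number_infinite_of_fixed_central:
  fixes G :: "'v pair_pre_digraph" and c :: nat
  assumes fin: "finite (pverts G)" and phi: "\<phi> \<in> hom (raag G) (raag G)"
    and R: "\<And>\<rho>. \<rho> \<in> R \<Longrightarrow> unirep (raag G) \<rho>"
    and R_phi: "\<And>\<rho>. \<rho> \<in> R \<Longrightarrow> (\<lambda>g. \<rho> (\<phi> g)) \<in> R"
    and y: "y \<in> carrier (raag G)" and deep: "\<And>\<rho>. \<rho> \<in> R \<Longrightarrow> depth_ge c (\<rho> y - 1)"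
    and fixed: "\<And>\<rho>. \<rho> \<in> R \<Longrightarrow> ent (\<rho> (\<phi> y)) 0 c = ent (\<rho> y) 0 c"
    and c: "c > 0" and \<rho>0: "\<rho>0 \<in> R" "ent (\<rho>0 y) 0 c \<noteq> 0"
  shows "reidemeister_number (raag G) \<phi> = \<infinity>"
proof -
  interpret group "raag G" by (rule group_raag)
  have phi_cl: "\<phi> g \<in> carrier (raag G)" if "g \<in> carrier (raag G)" for g
    using phi that by (auto simp: hom_def)
  let ?t = "\<bar>ent (\<rho>0 y) 0 c\<bar>"
  have ge: "enat m \<le> reidemeister_number (raag G) \<phi>" if m: "m > 0" for m
  proof -
    \<comment> \<open>The corner entry of y^t under \<open>\<rho>0\<close> is t times that of y, so
      modulo this q the powers with t < m stay distinct.\<close>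
    let ?q = "int m * ?t"
    have q: "?q > 0" using m \<rho>0 by simp
    define E where "E = (\<lambda>g. {h \<in> carrier (raag G). \<forall>\<rho> \<in> R. trunc ?q c (\<rho> g) = trunc ?q c (\<rho> h)})"
    have E_iff: "E g = E h \<longleftrightarrow> (\<forall>\<rho> \<in> R. trunc ?q c (\<rho> g) = trunc ?q c (\<rho> h))"
      if "g \<in> carrier (raag G)" "h \<in> carrier (raag G)" for g h
      using that by (auto simp: E_def)
    show ?thesis
    proof (rule reidemeister_number_ge[OF phi])
      show "finite (E ` carrier (raag G))"
        unfolding E_def by (rule finite_trunc_classes[OF fin q R])
      show "E (g \<otimes>\<^bsub>raag G\<^esub> h) = E (g' \<otimes>\<^bsub>raag G\<^esub> h')"
        if "g \<in> carrier (raag G)" "g' \<in> carrier (raag G)" "h \<in> carrier (raag G)" "h' \<in> carrier (raag G)"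
          "E g = E g'" "E h = E h'" for g g' h h'
        using that by (auto simp: E_iff unirepD(2)[OF R] intro!: trunc_mult_cong)
      show "E (\<phi> g) = E (\<phi> g')"
        if "g \<in> carrier (raag G)" "g' \<in> carrier (raag G)" "E g = E g'" for g g'
        unfolding E_iff[OF phi_cl[OF that(1)] phi_cl[OF that(2)]]
        using bspec[OF iffD1[OF E_iff[OF that(1,2)] that(3)] R_phi] by blast
      show "y \<in> carrier (raag G)" by (rule y)
      show "E (y \<otimes>\<^bsub>raag G\<^esub> g) = E (g \<otimes>\<^bsub>raag G\<^esub> y)" if g: "g \<in> carrier (raag G)" for g
      proof -
        have "trunc ?q c (\<rho> y * \<rho> g) = trunc ?q c (\<rho> g * \<rho> y)" if "\<rho> \<in> R" for \<rho>
        proof -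
          \<comment> \<open>Both products have depth c + 1, hence vanish in all entries kept by
            \<open>trunc\<close>.\<close>
          have "depth_ge (c + 1) ((\<rho> y - 1) * (\<rho> g - 1))" "depth_ge (1 + c) ((\<rho> g - 1) * (\<rho> y - 1))"
            using depth_ge_mult[OF deep[OF that] unirepD(3)[OF R[OF that] g]]
              depth_ge_mult[OF unirepD(3)[OF R[OF that] g] deep[OF that]] by blast+
          then have "ent ((\<rho> y - 1) * (\<rho> g - 1)) i j = ent ((\<rho> g - 1) * (\<rho> y - 1)) i j"
            if "j \<le> c" for i j
            using that depth_geD[of "c + 1" _ j i] depth_geD[of "1 + c" _ j i] by simp
          then have "ent (\<rho> y * \<rho> g) i j = ent (\<rho> g * \<rho> y) i j" if "j \<le> c" for i j
            using that by (simp add: algebra_simps)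
          then show ?thesis by (simp add: trunc_eq_iff)
        qed
        then show ?thesis
          using g y by (simp add: E_iff unirepD(2)[OF R])
      qed
      show "E (\<phi> y) = E y"
      proof -
        have "ent (\<rho> (\<phi> y)) i j = ent (\<rho> y) i j" if "\<rho> \<in> R" "j \<le> c" for \<rho> i j
        proof (cases "i = 0 \<and> j = c")
          case True
          then show ?thesis using fixed that by simp
        next
          case False
          then have "j < i + c" using that by linarith
          then have "ent (\<rho> (\<phi> y) - 1) i j = ent (\<rho> y - 1) i j"
            using depth_geD[OF deep[OF that(1)]] depth_geD[OF deep[OF R_phi[OF that(1)]]] by simp
          then show ?thesis by simp
        qed
        then show ?thesis using y phi_cl by (simp add: E_iff trunc_eq_iff)
      qed
      show "inj_on (\<lambda>t::nat. E (y [^]\<^bsub>raag G\<^esub> t)) {..<m}"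
      proof (rule inj_onI)
        fix t t' assume t: "t \<in> {..<m}" "t' \<in> {..<m}" and eq: "E (y [^]\<^bsub>raag G\<^esub> t) = E (y [^]\<^bsub>raag G\<^esub> t')"
        let ?e = "ent (\<rho>0 y) 0 c"
        note u = R[OF \<rho>0(1)]
        have pow: "depth_ge c (\<rho>0 (y [^]\<^bsub>raag G\<^esub> t) - 1) \<and> ent (\<rho>0 (y [^]\<^bsub>raag G\<^esub> t)) 0 c = int t * ?e" for t :: nat
        proof (induction t)
          case 0
          then show ?case using unirepD(1)[OF u] c by simp
        next
          case (Suc t)
          then show ?case
            using unirep_mult_lead[OF u c _ _ y deep[OF \<rho>0(1)], of "y [^]\<^bsub>raag G\<^esub> t"] y
            by (simp add: distrib_right)
        qed
        have "trunc ?q c (\<rho>0 (y [^]\<^bsub>raag G\<^esub> t)) = trunc ?q c (\<rho>0 (y [^]\<^bsub>raag G\<^esub> t'))"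
          using eq \<rho>0 y by (simp add: E_iff)
        then have "ent (\<rho>0 (y [^]\<^bsub>raag G\<^esub> t)) 0 c mod ?q = ent (\<rho>0 (y [^]\<^bsub>raag G\<^esub> t')) 0 c mod ?q"
          by (simp add: trunc_eq_iff)
        then have "(int t * ?e) mod ?q = (int t' * ?e) mod ?q"
          by (simp only: pow)
        then have "int m * ?t dvd (int t - int t') * ?e"
          by (simp add: mod_eq_dvd_iff algebra_simps)
        then have "int m * ?e dvd (int t - int t') * ?e"
          by (simp add: abs_if split: if_splits)
        then have "int m dvd int t - int t'"
          using \<rho>0(2) by simp
        then show "t = t'"
          using t zdvd_imp_le[of "int m" "\<bar>int t - int t'\<bar>"] by (cases "t = t'") auto
      qed
    qed
  qed
  show ?thesis
  proof (cases "reidemeister_number (raag G) \<phi>")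
    case (enat r)
    then show ?thesis using ge[of "Suc r"] by simp
  qed
qed

section \<open>Automorphisms on the abelianization\<close>

text \<open>The exponent sum of b, chosen as a character dual to the generator; that one exists is
  part of the lemma \<open>expo\<close>, which reads it off a superdiagonal entry.\<close>

definition expo :: "'v pair_pre_digraph \<Rightarrow> 'v \<Rightarrow> 'v word set \<Rightarrow> int" where
  "expo G b = (SOME \<chi>. additive_on (raag G) \<chi> \<and>
     (\<forall>v \<in> pverts G. \<chi> (gen G v) = (if v = b then 1 else 0)))"

lemma expo:
  shows additive_on_expo: "additive_on (raag G) (expo G b)"
    and expo_gen: "v \<in> pverts G \<Longrightarrow> expo G b (gen G v) = (if v = b then 1 else 0)"
proof -
  obtain \<rho> where \<rho>: "unirep (raag G) \<rho>"
    "\<forall>v \<in> pverts G. \<rho> (gen G v) = 1 + superdiag (\<lambda>p. if v = b then 1 else 0)"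
    using unirep_from_superdiag[of G "\<lambda>v p. if v = b then 1 else 0"] by auto
  have "\<exists>\<chi>. additive_on (raag G) \<chi> \<and> (\<forall>v \<in> pverts G. \<chi> (gen G v) = (if v = b then 1 else 0))"
    using \<rho>(2) by (intro exI[of _ "\<lambda>g. ent (\<rho> g) 0 (Suc 0)"] conjI additive_on_ent[OF \<rho>(1)])
      (auto simp: superdiag.rep_eq)
  from someI_ex[OF this] show "additive_on (raag G) (expo G b)"
    "v \<in> pverts G \<Longrightarrow> expo G b (gen G v) = (if v = b then 1 else 0)"
    by (auto simp: expo_def)
qed

lemma additive_on_expand:
  assumes fin: "finite (pverts G)" and add: "additive_on (raag G) \<chi>" and g: "g \<in> carrier (raag G)"
  shows "\<chi> g = (\<Sum>b \<in> pverts G. expo G b g * \<chi> (gen G b))"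
proof -
  interpret group "raag G" by (rule group_raag)
  have gen_cl: "gen G v \<in> carrier (raag G)" if "v \<in> pverts G" for v
    using that by (auto intro: raag_class_closed)
  have delta: "(\<Sum>b \<in> pverts G. expo G b (gen G v) * \<chi> (gen G b)) = \<chi> (gen G v)"
    if "v \<in> pverts G" for v
    using that fin by (simp add: expo_gen if_distrib[of "\<lambda>x. x * _"] cong: if_cong)
  show ?thesis
    using g
  proof (induction g rule: raag_induct)
    case one
    then show ?case by (simp add: additive_on_one[OF add] additive_on_one[OF additive_on_expo])
  next
    case (gen v g)
    then show ?case
      using delta[of v] gen_cl[of v]
      by (simp add: additive_onD[OF add] additive_onD[OF additive_on_expo] distrib_right sum.distrib)
  next
    case (inv_gen v g)
    then show ?case
      using delta[of v] gen_cl[of v]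
      by (simp add: additive_onD[OF add] additive_onD[OF additive_on_expo] additive_on_inv[OF add]
          additive_on_inv[OF additive_on_expo] left_diff_distrib sum_subtractf)
  qed
qed

text \<open>The Heisenberg representation sends a and b to the two elementary superdiagonal matrices
  and all other generators to 1; it exists because a and b are not adjacent. The two sides are the
  (0, 2) entries of \<open>(\<rho> g - 1) * (\<rho> h - 1)\<close> and of the product in the other
  order.\<close>

lemma expo_commute:
  assumes fin: "finite (pverts G)" and ab: "a \<in> pverts G" "b \<in> pverts G" "a \<noteq> b"
    "(a, b) \<notin> parcs G" "(b, a) \<notin> parcs G"
    and gh: "g \<in> carrier (raag G)" "h \<in> carrier (raag G)"
    and comm: "g \<otimes>\<^bsub>raag G\<^esub> h = h \<otimes>\<^bsub>raag G\<^esub> g"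
  shows "expo G a g * expo G b h = expo G a h * expo G b g"
proof -
  define f where "f v p = (if p = 0 \<and> v = a \<or> p = Suc 0 \<and> v = b then 1 else 0 :: int)" for v p
  have "f v p * f w (Suc p) = f w p * f v (Suc p)" if "(v, w) \<in> parcs G" for v w p
    using that ab by (auto simp: f_def)
  then obtain \<rho> where \<rho>: "unirep (raag G) \<rho>" "\<forall>v \<in> pverts G. \<rho> (gen G v) = 1 + superdiag (f v)"
    using unirep_from_superdiag[of G f] by auto
  have super: "ent (\<rho> x) p (Suc p) = (\<Sum>v \<in> pverts G. expo G v x * f v p)"
    if "x \<in> carrier (raag G)" for x p
    using additive_on_expand[OF fin additive_on_ent[OF \<rho>(1)] that, of p] \<rho>(2)
    by (simp add: superdiag.rep_eq)
  have a: "ent (\<rho> x) 0 (Suc 0) = expo G a x" and b: "ent (\<rho> x) (Suc 0) (Suc (Suc 0)) = expo G b x"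
    if "x \<in> carrier (raag G)" for x
    using that fin ab by (simp_all add: super f_def if_distrib[of "\<lambda>x. _ * x"] cong: if_cong)
  have lead: "ent ((\<rho> x - 1) * (\<rho> y - 1)) 0 (Suc (Suc 0)) = expo G a x * expo G b y"
    if "x \<in> carrier (raag G)" "y \<in> carrier (raag G)" for x y
    using ent_mult_lead[OF unirepD(3)[OF \<rho>(1) that(1)] unirepD(3)[OF \<rho>(1) that(2)], of 0] that
    by (simp add: a b)
  have "\<rho> g * \<rho> h = \<rho> h * \<rho> g"
    using comm gh unirepD(2)[OF \<rho>(1)] by metis
  then have "(\<rho> g - 1) * (\<rho> h - 1) = (\<rho> h - 1) * (\<rho> g - 1)"
    by (simp add: algebra_simps)
  then show ?thesis
    using lead[of g h] lead[of h g] gh by (simp add: mult.commute)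
qed

text \<open>The vectors become the columns of a square matrix padded with zero rows. There are fewer
  coordinates than vectors, so some row is zero, the determinant vanishes and a nonzero integer
  kernel vector exists.\<close>

lemma int_relation_exists:
  fixes r :: "'a \<Rightarrow> 'b \<Rightarrow> int"
  assumes S: "finite S" and T: "finite T" and card: "card T < card S"
  shows "\<exists>t. (\<exists>s \<in> S. t s \<noteq> 0) \<and> (\<forall>b \<in> T. (\<Sum>s \<in> S. t s * r s b) = 0)"
proof -
  let ?n = "card S"
  obtain f where f: "bij_betw f {0..<?n} S" using S ex_bij_betw_nat_finite by blast
  obtain g where g: "bij_betw g {0..<card T} T" using T ex_bij_betw_nat_finite by blast
  define A where "A = mat ?n ?n (\<lambda>(i, j). if i < card T then r (f j) (g i) else 0)"
  have A: "A \<in> carrier_mat ?n ?n" by (simp add: A_def)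
  have "signof p * (\<Prod>i = 0..<?n. A $$ (i, p i)) = 0" if "p permutes {0..<?n}" for p
  proof -
    have "A $$ (card T, p (card T)) = 0"
      using card permutes_in_image[OF that, of "card T"] by (simp add: A_def)
    then show ?thesis using card by (auto intro!: prod_zero)
  qed
  then have "det A = 0"
    unfolding det_def'[OF A] by (intro sum.neutral) auto
  then obtain v where v: "v \<in> carrier_vec ?n" "v \<noteq> 0\<^sub>v ?n" "A *\<^sub>v v = 0\<^sub>v ?n"
    using det_0_iff_vec_prod_zero[OF A] by auto
  define t where "t s = v $ (inv_into {0..<?n} f s)" for s
  have tf: "t (f j) = v $ j" if "j < ?n" for j
    using that f by (simp add: t_def bij_betw_def inv_into_f_f)
  have "\<exists>s \<in> S. t s \<noteq> 0"
  proof -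
    obtain j where "j < ?n" "v $ j \<noteq> 0"
      using v(1,2) by (metis carrier_vecD eq_vecI index_zero_vec(1,2))
    then show ?thesis
      using tf f by (intro bexI[of _ "f j"]) (auto simp: bij_betw_def)
  qed
  moreover have "(\<Sum>s \<in> S. t s * r s b) = 0" if b: "b \<in> T" for b
  proof -
    obtain i where i: "i < card T" "b = g i" using b bij_betw_imp_surj_on[OF g] by force
    have "(A *\<^sub>v v) $ i = 0" using v(3) i card by simp
    moreover have "(A *\<^sub>v v) $ i = (\<Sum>j = 0..<?n. r (f j) b * v $ j)"
      using i card v(1) by (simp add: A_def scalar_prod_def row_def)
    moreover have "(\<Sum>s \<in> S. t s * r s b) = (\<Sum>j = 0..<?n. t (f j) * r (f j) b)"
      by (rule sum.reindex_bij_betw[OF f, symmetric])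
    ultimately show ?thesis by (simp add: tf mult.commute)
  qed
  ultimately show ?thesis by blast
qed

text \<open>The inverse \<psi> is a parameter, with inverse laws on the carrier only, so that
  exchanging \<phi> and \<psi> gives another instance, as in \<open>inverse_aut\<close>.\<close>

locale raag_aut =
  fixes G :: "'v pair_pre_digraph" and \<phi> \<psi> :: "'v word set \<Rightarrow> 'v word set"
  assumes pair_graph: "pair_graph G"
    and phi: "\<phi> \<in> hom (raag G) (raag G)" and psi: "\<psi> \<in> hom (raag G) (raag G)"
    and psi_phi: "g \<in> carrier (raag G) \<Longrightarrow> \<psi> (\<phi> g) = g"
    and phi_psi: "g \<in> carrier (raag G) \<Longrightarrow> \<phi> (\<psi> g) = g"
begin

sublocale pair_graph G
  by (rule pair_graph)

definition M :: "'v \<Rightarrow> 'v \<Rightarrow> int" where "M a b = expo G b (\<phi> (gen G a))"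

lemma phi_closed: "g \<in> carrier (raag G) \<Longrightarrow> \<phi> g \<in> carrier (raag G)"
  using phi by (auto simp: hom_def)

lemma psi_closed: "g \<in> carrier (raag G) \<Longrightarrow> \<psi> g \<in> carrier (raag G)"
  using psi by (auto simp: hom_def)

lemma gen_closed: "v \<in> pverts G \<Longrightarrow> gen G v \<in> carrier (raag G)"
  by (auto intro: raag_class_closed)

lemma additive_on_phi: "additive_on (raag G) \<chi> \<Longrightarrow> additive_on (raag G) (\<lambda>g. \<chi> (\<phi> g))"
  by (auto simp: additive_on_def hom_mult[OF phi] phi_closed)

lemma additive_on_psi: "additive_on (raag G) \<chi> \<Longrightarrow> additive_on (raag G) (\<lambda>g. \<chi> (\<psi> g))"
  by (auto simp: additive_on_def hom_mult[OF psi] psi_closed)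

lemma additive_phi_gen:
  assumes "additive_on (raag G) \<chi>" "a \<in> pverts G"
  shows "\<chi> (\<phi> (gen G a)) = (\<Sum>b \<in> pverts G. M a b * \<chi> (gen G b))"
  using additive_on_expand[OF pair_finite_verts assms(1) phi_closed[OF gen_closed[OF assms(2)]]]
  by (simp add: M_def)

text \<open>This is the character \<open>expo G b\<close> composed with \<psi>, evaluated at the
  image of a under \<phi> and expanded in coordinates.\<close>

lemma M_mult_inverse:
  assumes "a \<in> pverts G" "b \<in> pverts G"
  shows "(\<Sum>c \<in> pverts G. M a c * expo G b (\<psi> (gen G c))) = (if a = b then 1 else 0)"
  using additive_phi_gen[OF additive_on_psi[OF additive_on_expo] assms(1)] assms
  by (simp add: psi_phi gen_closed expo_gen)

lemma M_commute:
  assumes ab: "a \<in> pverts G" "b \<in> pverts G" "a \<noteq> b" "(a, b) \<notin> parcs G"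
    and s: "(w, s) \<in> parcs G"
  shows "M w a * M s b = M s a * M w b"
proof -
  have ws: "w \<in> pverts G" "s \<in> pverts G" using wellformed'[OF s] by auto
  have "(b, a) \<notin> parcs G" using ab(4) arcs_symmetric[of b a] by auto
  then show ?thesis
    unfolding M_def
    using ab ws gen_commute[OF pair_graph s]
    by (intro expo_commute[OF pair_finite_verts]) (auto simp: phi_closed gen_closed hom_mult[OF phi, symmetric])
qed

text \<open>Multiplying the relation by column a of the inverse matrix isolates the coefficient of
  a.\<close>

lemma M_independent:
  assumes S: "S \<subseteq> pverts G" and zero: "\<And>b. b \<in> pverts G \<Longrightarrow> (\<Sum>s \<in> S. t s * M s b) = 0"
    and a: "a \<in> S"
  shows "t a = 0"
proof -
  have fin: "finite S" using S finite_subset pair_finite_verts by blast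
  have "0 = (\<Sum>b \<in> pverts G. (\<Sum>s \<in> S. t s * M s b) * expo G a (\<psi> (gen G b)))"
    by (simp add: zero)
  also have "\<dots> = (\<Sum>s \<in> S. t s * (\<Sum>b \<in> pverts G. M s b * expo G a (\<psi> (gen G b))))"
    unfolding sum_distrib_right sum_distrib_left by (subst sum.swap) (simp add: mult.assoc)
  also have "\<dots> = (\<Sum>s \<in> S. t s * (if s = a then 1 else 0))"
    using S a by (intro sum.cong HOL.refl) (simp add: M_mult_inverse subset_iff)
  also have "\<dots> = t a"
    using a fin by (simp add: if_distrib[of "\<lambda>x. _ * x"] cong: if_cong)
  finally show ?thesis by simp
qed

text \<open>The commuting elements \<open>\<phi> s\<close> with s in the star of w have independent exponent vectors,
  and each such vector is determined by its coordinates in T.\<close>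
lemma card_lk_less:
  assumes w: "w \<in> pverts G" and T: "T \<subseteq> pverts G"
    and det: "\<And>b. b \<in> pverts G - T \<Longrightarrow> \<exists>a \<in> T. (a, b) \<notin> parcs G \<and> M w a \<noteq> 0"
  shows "card (lk G w) < card T"
proof (rule ccontr)
  assume "\<not> card (lk G w) < card T"
  moreover have lk: "lk G w \<subseteq> pverts G" "w \<notin> lk G w" "finite (lk G w)"
    using no_loops'[of w] pair_finite_verts by (auto simp: lk_def)
  ultimately have card: "card T < card (insert w (lk G w))"
    by simp
  have "finite T" using T finite_subset pair_finite_verts by blast
  then obtain t s where s: "s \<in> insert w (lk G w)" "t s \<noteq> 0"
    and t: "\<And>b. b \<in> T \<Longrightarrow> (\<Sum>s \<in> insert w (lk G w). t s * M s b) = 0"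
    using int_relation_exists[OF _ _ card, of M] lk by auto
  have "(\<Sum>s \<in> insert w (lk G w). t s * M s b) = 0" if b: "b \<in> pverts G" for b
  proof (cases "b \<in> T")
    case False
    then obtain a where a: "a \<in> T" "(a, b) \<notin> parcs G" "M w a \<noteq> 0" using det b by blast
    then have "a \<in> pverts G" "a \<noteq> b" using T False by auto
    then have comm: "M w a * M s b = M s a * M w b" if "s \<in> insert w (lk G w)" for s
      using that a(2) b M_commute[of a b w s] by (auto simp: lk_def)
    \<comment> \<open>\<open>M w a\<close> is nonzero, and \<open>M_commute\<close> trades column b
      for column a, where the relation already holds.\<close>
    have "M w a * (\<Sum>s \<in> insert w (lk G w). t s * M s b) = (\<Sum>s \<in> insert w (lk G w). t s * (M w a * M s b))"
      by (simp only: sum_distrib_left mult.left_commute)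
    also have "\<dots> = (\<Sum>s \<in> insert w (lk G w). t s * M s a) * M w b"
      unfolding sum_distrib_right by (intro sum.cong HOL.refl) (simp only: comm mult.assoc)
    also have "\<dots> = 0" using t[OF a(1)] by simp
    finally show ?thesis using a(3) by simp
  qed (rule t)
  then have "t s = 0"
    using M_independent[of "insert w (lk G w)" t s] s(1) lk w by auto
  with s(2) show False by simp
qed

end

section \<open>Supports and determinants of blocks of \<open>M\<close>\<close>

context raag_aut
begin

lemma M_support_card_le:
  assumes A: "A \<subseteq> pverts G" and B: "B \<subseteq> pverts G"
    and supp: "\<And>a b. a \<in> A \<Longrightarrow> b \<in> pverts G - B \<Longrightarrow> M a b = 0"
  shows "card A \<le> card B"
proof (rule ccontr)
  assume "\<not> card A \<le> card B"
  moreover have fin: "finite A" "finite B"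
    using A B finite_subset pair_finite_verts by blast+
  ultimately obtain t s where s: "s \<in> A" "t s \<noteq> 0"
    and t: "\<And>b. b \<in> B \<Longrightarrow> (\<Sum>s \<in> A. t s * M s b) = 0"
    using int_relation_exists[OF fin, of M] by auto
  have "(\<Sum>s \<in> A. t s * M s b) = 0" if "b \<in> pverts G" for b
    using t supp that by (cases "b \<in> B") auto
  then have "t s = 0"
    using M_independent[OF A _ s(1), of t] by blast
  with s(2) show False by simp
qed

text \<open>The rows in A vanish outside the columns B, so the product of \<open>M\<close> with its
  inverse can be summed over B alone. The block therefore has an integer right inverse, and its
  determinant is a unit.\<close>

lemma det_M_support:
  assumes w: "bij_betw w {..<k} A" "A \<subseteq> pverts G" and w': "bij_betw w' {..<k} B" "B \<subseteq> pverts G"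
    and supp: "\<And>a b. a \<in> A \<Longrightarrow> b \<in> pverts G - B \<Longrightarrow> M a b = 0"
  shows "det (mat k k (\<lambda>(i, j). M (w i) (w' j))) \<in> {1, -1}"
proof -
  define P where "P = mat k k (\<lambda>(i, j). M (w i) (w' j))"
  define Q where "Q = mat k k (\<lambda>(j, l). expo G (w l) (\<psi> (gen G (w' j))))"
  have "P * Q = 1\<^sub>m k"
  proof (rule eq_matI)
    fix i l assume "i < dim_row (1\<^sub>m k :: int mat)" "l < dim_col (1\<^sub>m k :: int mat)"
    then have il: "i < k" "l < k" by auto
    then have V: "w i \<in> A" "w l \<in> A" using w(1) by (auto simp: bij_betw_def)
    have "(P * Q) $$ (i, l) = (\<Sum>j = 0..<k. M (w i) (w' j) * expo G (w l) (\<psi> (gen G (w' j))))"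
      using il by (simp add: P_def Q_def scalar_prod_def)
    also have "\<dots> = (\<Sum>c \<in> B. M (w i) c * expo G (w l) (\<psi> (gen G c)))"
      using w'(1) by (intro sum.reindex_bij_betw) (simp add: lessThan_atLeast0)
    also have "\<dots> = (\<Sum>c \<in> pverts G. M (w i) c * expo G (w l) (\<psi> (gen G c)))"
      using w'(2) pair_finite_verts supp[OF V(1)] by (intro sum.mono_neutral_left) auto
    also have "\<dots> = (if w i = w l then 1 else 0)"
      using V w(2) by (intro M_mult_inverse) auto
    also have "\<dots> = 1\<^sub>m k $$ (i, l)"
      using il inj_onD[OF bij_betw_imp_inj_on[OF w(1)], of i l] by auto
    finally show "(P * Q) $$ (i, l) = 1\<^sub>m k $$ (i, l)" .
  qed (simp_all add: P_def Q_def)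
  then have "det P * det Q = 1"
    using det_mult[of P k Q] by (simp add: P_def Q_def)
  then show ?thesis
    using zmult_eq_1_iff[of "det P"] by (auto simp: P_def)
qed

end

text \<open>The assumptions are symmetric in v1, v2 and in \<phi>, \<psi>, which yields mirrored
  statements by \<open>swap\<close> and \<open>inverse_aut\<close>. \<open>card_lk\<close> is what
  maximality of the other degrees gives; \<open>proper\<close> says that
  \<open>lk G v1 - {v2}\<close> and \<open>lk G v2 - {v1}\<close> are nonempty.\<close>

locale split_aut = raag_aut G \<phi> \<psi> for G :: "'v pair_pre_digraph" and \<phi> \<psi> +
  fixes v1 v2 :: 'v
  assumes lk_union: "lk G v1 \<union> lk G v2 = pverts G"
    and lk_disjoint: "lk G v1 \<inter> lk G v2 = {}"
    and v12: "v1 \<in> pverts G" "v2 \<in> pverts G"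
    and card_lk: "\<And>w. w \<in> pverts G \<Longrightarrow> w \<noteq> v1 \<Longrightarrow> w \<noteq> v2 \<Longrightarrow>
      card (lk G v1) < card (lk G w) \<and> card (lk G v2) < card (lk G w)"
    and proper: "\<not> lk G v1 \<subseteq> {v2}" "\<not> lk G v2 \<subseteq> {v1}"
begin

lemma swap: "split_aut G \<phi> \<psi> v2 v1"
  using lk_union lk_disjoint v12 card_lk proper by unfold_locales auto

lemma in_lk: "w \<in> lk G v \<longleftrightarrow> (v, w) \<in> parcs G"
  using wellformed'[of v w] by (auto simp: lk_def)

lemma v1_neq_v2: "v1 \<noteq> v2"
  using lk_union lk_disjoint v12 by auto

lemma v2_in_lk: "v2 \<in> lk G v1"
proof -
  have "v2 \<notin> lk G v2" using no_loops'[of v2] by (auto simp: in_lk)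
  then show ?thesis using lk_union v12 by auto
qed

lemma lk_lk: "w \<in> pverts G \<Longrightarrow> w \<in> lk G v2 \<longleftrightarrow> w \<notin> lk G v1"
  using lk_union lk_disjoint by auto

text \<open>Otherwise \<open>card_lk_less\<close> applies with T the star of v1, since a vertex
  outside it is not adjacent to v1. Then the degree of w is at most that of v1, against
  \<open>card_lk\<close>.\<close>

lemma M_other_v1:
  assumes "w \<in> pverts G - {v1, v2}"
  shows "M w v1 = 0"
proof (rule ccontr)
  assume nz: "M w v1 \<noteq> 0"
  have "card (lk G w) < card (insert v1 (lk G v1))"
  proof (rule card_lk_less)
    show "insert v1 (lk G v1) \<subseteq> pverts G"
      using v12 by (auto simp: lk_def)
    show "\<exists>a \<in> insert v1 (lk G v1). (a, b) \<notin> parcs G \<and> M w a \<noteq> 0"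
      if "b \<in> pverts G - insert v1 (lk G v1)" for b
      using that nz by (auto simp: in_lk)
  qed (use assms in auto)
  also have "\<dots> \<le> card (lk G v1) + 1"
    by (simp add: card_insert_le_m1 card_insert_if lk_def pair_finite_verts)
  finally show False
    using card_lk[of w] assms by auto
qed

text \<open>Otherwise \<open>card_lk_less\<close> applies with T = {v1, v2}: as the links are
  disjoint, any further vertex is non-adjacent to v1 or to v2. Then v1 has degree at most 1, but its
  link contains v2 and, by \<open>proper\<close>, another vertex.\<close>

lemma M_v1_v1_or_v2: "M v1 v1 = 0 \<or> M v1 v2 = 0"
proof (rule ccontr)
  assume nz: "\<not> ?thesis"
  have "card (lk G v1) < card {v1, v2}"
  proof (rule card_lk_less)
    show "\<exists>a \<in> {v1, v2}. (a, b) \<notin> parcs G \<and> M v1 a \<noteq> 0" if "b \<in> pverts G - {v1, v2}" for b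
      using that nz lk_lk[of b] by (auto simp: in_lk)
  qed (use v12 in auto)
  then have "card (lk G v1) \<le> 1"
    by (simp add: card_insert_if split: if_splits)
  moreover have "finite (lk G v1)"
    using pair_finite_verts by (simp add: lk_def)
  ultimately have "a = b" if "a \<in> lk G v1" "b \<in> lk G v1" for a b
    using that by (metis One_nat_def card_le_Suc0_iff_eq)
  then show False
    using v2_in_lk proper(1) by blast
qed

lemma M_other_v2: "w \<in> pverts G - {v1, v2} \<Longrightarrow> M w v2 = 0"
  using split_aut.M_other_v1[OF swap] by (simp add: insert_commute)

lemma M_v2_v1_or_v2: "M v2 v1 = 0 \<or> M v2 v2 = 0"
  using split_aut.M_v1_v1_or_v2[OF swap] by auto

lemma inverse_aut: "split_aut G \<psi> \<phi> v1 v2"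
  using lk_union lk_disjoint v12 card_lk proper phi psi phi_psi psi_phi pair_graph
  by unfold_locales auto

text \<open>Since \<psi> sends the other vertices to exponent vectors vanishing at v1 and v2, the 2
  by 2 blocks of \<phi> and \<psi> at v1, v2 are inverse to each other. Each row of the block of
  \<open>M\<close> contains a zero, which leaves the signed permutation matrices.\<close>

lemma M_monomial:
  "M v1 v2 = 0 \<and> M v2 v1 = 0 \<and> M v1 v1 \<in> {1, -1} \<and> M v2 v2 \<in> {1, -1} \<or>
   M v1 v1 = 0 \<and> M v2 v2 = 0 \<and> M v1 v2 \<in> {1, -1} \<and> M v2 v1 \<in> {1, -1}"
proof -
  define N where "N a b = expo G b (\<psi> (gen G a))" for a b
  interpret inv: split_aut G \<psi> \<phi> v1 v2 by (rule inverse_aut)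
  have N_other: "N c v1 = 0 \<and> N c v2 = 0" if "c \<in> pverts G - {v1, v2}" for c
    using inv.M_other_v1[OF that] inv.M_other_v2[OF that] by (simp add: inv.M_def N_def)
  have eq: "M a v1 * N v1 b + M a v2 * N v2 b = (if a = b then 1 else 0)"
    if "a \<in> {v1, v2}" "b \<in> {v1, v2}" for a b
  proof -
    have "(\<Sum>c \<in> pverts G. M a c * N c b) = (\<Sum>c \<in> {v1, v2}. M a c * N c b)"
      using that v12 pair_finite_verts N_other by (intro sum.mono_neutral_right) auto
    then show ?thesis
      using M_mult_inverse[of a b] that v12 v1_neq_v2 by (auto simp: N_def)
  qed
  have "M v1 v1 * N v1 v1 + M v1 v2 * N v2 v1 = 1" "M v2 v1 * N v1 v2 + M v2 v2 * N v2 v2 = 1"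
    "M v1 v1 * N v1 v2 + M v1 v2 * N v2 v2 = 0" "M v2 v1 * N v1 v1 + M v2 v2 * N v2 v1 = 0"
    using eq[of v1 v1] eq[of v2 v2] eq[of v1 v2] eq[of v2 v1] v1_neq_v2 by auto
  then show ?thesis
    using M_v1_v1_or_v2 M_v2_v1_or_v2 zmult_eq_1_iff by (elim disjE) auto
qed

text \<open>The images of w and v2 commute, and at u the image of v2 has a nonzero coordinate while
  that of w has none; proportionality at the non-adjacent pair u, b kills the b-coordinate of w. For
  u = v2 the span of W2 is preserved, for u = v1 it goes into that of W1.\<close>

lemma M_support_lk:
  assumes u: "u \<in> {v1, v2}" "M v2 u \<noteq> 0" and w: "w \<in> lk G v2 - {v1}"
    and b: "b \<in> pverts G - (lk G u - {v1, v2})"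
  shows "M w b = 0"
proof -
  have wV: "w \<in> pverts G - {v1, v2}"
    using w no_loops'[of v2] by (auto simp: in_lk lk_def)
  show ?thesis
  proof (cases "b \<in> {v1, v2}")
    case True
    then show ?thesis using M_other_v1[OF wV] M_other_v2[OF wV] by auto
  next
    case False
    have "M v2 u * M w b = M w u * M v2 b"
      using b u False w v12 by (intro M_commute) (auto simp: in_lk)
    moreover have "M w u = 0"
      using M_other_v1[OF wV] M_other_v2[OF wV] u by auto
    ultimately show ?thesis using u by simp
  qed
qed

end

section \<open>Leading entries of iterated commutators\<close>

datatype 'l comm_tree = Leaf 'l | Node "'l comm_tree" "'l comm_tree"

primrec width :: "'l comm_tree \<Rightarrow> nat" where
  "width (Leaf l) = 1"
| "width (Node s t) = width s + width t"

primrec count_leaves :: "('l \<Rightarrow> bool) \<Rightarrow> 'l comm_tree \<Rightarrow> nat" where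
  "count_leaves Q (Leaf l) = (if Q l then 1 else 0)"
| "count_leaves Q (Node s t) = count_leaves Q s + count_leaves Q t"

text \<open>If \<open>x l\<close> is the superdiagonal of the unitriangular matrix of the letter l, this is the first
  nontrivial diagonal of the matrix of the iterated commutator.\<close>
primrec lead :: "('l \<Rightarrow> nat \<Rightarrow> int) \<Rightarrow> 'l comm_tree \<Rightarrow> nat \<Rightarrow> int" where
  "lead x (Leaf l) p = x l p"
| "lead x (Node s t) p = lead x s p * lead x t (p + width s) - lead x t p * lead x s (p + width t)"

definition commutator :: "('a, 'b) monoid_scheme \<Rightarrow> 'a \<Rightarrow> 'a \<Rightarrow> 'a" where
  "commutator A g h = g \<otimes>\<^bsub>A\<^esub> h \<otimes>\<^bsub>A\<^esub> inv\<^bsub>A\<^esub> (h \<otimes>\<^bsub>A\<^esub> g)"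

primrec comm_eval :: "('a, 'b) monoid_scheme \<Rightarrow> ('l \<Rightarrow> 'a) \<Rightarrow> 'l comm_tree \<Rightarrow> 'a" where
  "comm_eval A g (Leaf l) = g l"
| "comm_eval A g (Node s t) = commutator A (comm_eval A g s) (comm_eval A g t)"

lemma width_neq_0 [simp]: "width t \<noteq> 0"
  by (induction t) auto

lemma width_pos: "width t > 0"
  by (intro gr0I) simp

lemma (in group) comm_eval_closed:
  "(\<And>l. l \<in> set_comm_tree t \<Longrightarrow> g l \<in> carrier G) \<Longrightarrow> comm_eval G g t \<in> carrier G"
  by (induction t) (auto simp: commutator_def)

text \<open>With x, y the matrices of g, h minus 1, the matrix of the commutator minus 1 is x y - y
  x times a unitriangular matrix, and such a factor leaves the leading diagonal unchanged.\<close>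

lemma (in group) unirep_commutator:
  assumes \<rho>: "unirep G \<rho>" and g: "g \<in> carrier G" "depth_ge m (\<rho> g - 1)"
    and h: "h \<in> carrier G" "depth_ge n (\<rho> h - 1)"
  shows "depth_ge (m + n) (\<rho> (commutator G g h) - 1)"
    and "ent (\<rho> (commutator G g h) - 1) p (p + m + n) =
      ent (\<rho> g - 1) p (p + m) * ent (\<rho> h - 1) (p + m) (p + m + n)
      - ent (\<rho> h - 1) p (p + n) * ent (\<rho> g - 1) (p + n) (p + n + m)"
proof -
  define x y R where "x = \<rho> g - 1" and "y = \<rho> h - 1" and "R = \<rho> (inv (h \<otimes> g))"
  have R: "depth_ge 1 (R - 1)" using unirepD(3)[OF \<rho>] g h by (simp add: R_def)
  have "\<rho> (h \<otimes> g) * R = 1"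
    using unirepD(2)[OF \<rho>, of "h \<otimes> g" "inv (h \<otimes> g)"] g h unirepD(1)[OF \<rho>] by (simp add: R_def)
  then have inv: "\<rho> h * \<rho> g * R = 1"
    using unirepD(2)[OF \<rho> h(1) g(1)] by simp
  have "\<rho> (commutator G g h) = \<rho> g * \<rho> h * R"
    using g h unirepD(2)[OF \<rho>] by (simp add: commutator_def R_def)
  also have "\<dots> = (\<rho> g * \<rho> h - \<rho> h * \<rho> g) * R + 1"
    using inv by (simp add: left_diff_distrib)
  also have "\<rho> g * \<rho> h - \<rho> h * \<rho> g = x * y - y * x"
    by (simp add: x_def y_def algebra_simps)
  finally have eq: "\<rho> (commutator G g h) - 1 = (x * y - y * x) + (x * y - y * x) * (R - 1)"
    by (simp add: algebra_simps)
  have x: "depth_ge m x" and y: "depth_ge n y" using g h by (simp_all add: x_def y_def)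
  have xy: "depth_ge (m + n) (x * y - y * x)"
    using depth_ge_mult[OF x y] depth_ge_mult[OF y x] by (simp add: depth_ge_diff add.commute)
  note xyR = depth_ge_mult[OF xy R]
  show "depth_ge (m + n) (\<rho> (commutator G g h) - 1)"
    unfolding eq using xy depth_ge_mono[OF xyR, of "m + n"] by (simp add: depth_ge_add)
  have "ent ((x * y - y * x) * (R - 1)) p (p + m + n) = 0"
    using depth_geD[OF xyR] by simp
  moreover have "ent (x * y) p (p + m + n) = ent x p (p + m) * ent y (p + m) (p + m + n)"
    by (rule ent_mult_lead[OF x y])
  moreover have "ent (y * x) p (p + m + n) = ent y p (p + n) * ent x (p + n) (p + n + m)"
    using ent_mult_lead[OF y x, of p] by (simp add: add.assoc add.commute[of n m])
  ultimately show "ent (\<rho> (commutator G g h) - 1) p (p + m + n) =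
      ent (\<rho> g - 1) p (p + m) * ent (\<rho> h - 1) (p + m) (p + m + n)
      - ent (\<rho> h - 1) p (p + n) * ent (\<rho> g - 1) (p + n) (p + n + m)"
    unfolding eq x_def[symmetric] y_def[symmetric] plus_tri.rep_eq minus_tri.rep_eq by linarith
qed

lemma (in group) unirep_comm_eval:
  assumes \<rho>: "unirep G \<rho>" and g: "\<And>l. l \<in> set_comm_tree t \<Longrightarrow> g l \<in> carrier G"
  shows "depth_ge (width t) (\<rho> (comm_eval G g t) - 1)"
    and "ent (\<rho> (comm_eval G g t)) p (p + width t) = lead (\<lambda>l p. ent (\<rho> (g l)) p (Suc p)) t p"
proof -
  have "depth_ge (width t) (\<rho> (comm_eval G g t) - 1) \<and>
    (\<forall>p. ent (\<rho> (comm_eval G g t) - 1) p (p + width t) = lead (\<lambda>l p. ent (\<rho> (g l)) p (Suc p)) t p)"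
    using g
  proof (induction t)
    case (Leaf l)
    then show ?case using unirepD(3)[OF \<rho>, of "g l"] by simp
  next
    case (Node s t)
    then have cl: "comm_eval G g s \<in> carrier G" "comm_eval G g t \<in> carrier G"
      by (auto intro: comm_eval_closed)
    from Node have s: "depth_ge (width s) (\<rho> (comm_eval G g s) - 1)"
      and t: "depth_ge (width t) (\<rho> (comm_eval G g t) - 1)" by auto
    show ?case
      using unirep_commutator(1)[OF \<rho> cl(1) s cl(2) t] unirep_commutator(2)[OF \<rho> cl(1) s cl(2) t] Node
      by (simp only: comm_eval.simps width.simps lead.simps add.assoc[symmetric]) simp
  qed
  then show "depth_ge (width t) (\<rho> (comm_eval G g t) - 1)"
    and "ent (\<rho> (comm_eval G g t)) p (p + width t) = lead (\<lambda>l p. ent (\<rho> (g l)) p (Suc p)) t p"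
    by auto
qed

lemma lead_cong: "(\<And>l. l \<in> set_comm_tree t \<Longrightarrow> x l = y l) \<Longrightarrow> lead x t p = lead y t p"
  by (induction t arbitrary: p) auto

lemma card_window_add:
  "card ({p..<p + (m + n)} \<inter> S) = card ({p..<p + m} \<inter> S) + card ({p + m..<p + m + n} \<inter> S)"
  for p m n :: nat
proof -
  have "{p..<p + (m + n)} \<inter> S = ({p..<p + m} \<inter> S) \<union> ({p + m..<p + m + n} \<inter> S)"
    by auto
  then show ?thesis
    by (simp only:) (rule card_Un_disjoint; auto)
qed

text \<open>In each term of \<open>lead\<close> the leaves occupy the positions of the window
  bijectively. If the Q-leaves outnumber the positions in S, one of them stands outside S and
  contributes 0.\<close>

lemma lead_eq_0:
  assumes "\<And>l q. l \<in> set_comm_tree t \<Longrightarrow> Q l \<Longrightarrow> q \<notin> S \<Longrightarrow> x l q = 0"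
    and "card ({p..<p + width t} \<inter> S) < count_leaves Q t"
  shows "lead x t p = 0"
  using assms
proof (induction t arbitrary: p)
  case (Leaf l)
  then show ?case by (auto split: if_splits simp: Int_insert_left)
next
  case (Node s t)
  have "lead x s p' = 0 \<or> lead x t q' = 0"
    if "card ({p'..<p' + width s} \<inter> S) + card ({q'..<q' + width t} \<inter> S) < count_leaves Q (Node s t)" for p' q'
    using Node.IH(1)[of p'] Node.IH(2)[of q'] Node.prems(1) that by fastforce
  from this[of p "p + width s"] this[of "p + width t" p] show ?case
    using Node.prems(2) card_window_add[of p "width s" "width t" S] card_window_add[of p "width t" "width s" S]
    by (auto simp: add.commute)
qed

text \<open>In a nonzero term all Q-leaves stand in S; being at least as many as its positions in
  the window, they fill them. All other leaves then stand outside S, where x and y agree.\<close>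

lemma lead_eq_if_agree:
  assumes "\<And>l q. l \<in> set_comm_tree t \<Longrightarrow> Q l \<Longrightarrow> q \<notin> S \<Longrightarrow> x l q = 0"
    and "\<And>l q. l \<in> set_comm_tree t \<Longrightarrow> Q l \<or> q \<notin> S \<Longrightarrow> x l q = y l q"
    and "card ({p..<p + width t} \<inter> S) \<le> count_leaves Q t"
  shows "lead x t p = lead y t p"
  using assms
proof (induction t arbitrary: p)
  case (Leaf l)
  then show ?case by (auto split: if_splits simp: Int_insert_left)
next
  case (Node s t)
  have zero: "x l q = 0" "y l q = 0" if "l \<in> set_comm_tree (Node s t)" "Q l" "q \<notin> S" for l q
    using Node.prems(1,2) that by metis+
  have *: "lead x s p' * lead x t q' = lead y s p' * lead y t q'"
    if le: "card ({p'..<p' + width s} \<inter> S) + card ({q'..<q' + width t} \<inter> S) \<le> count_leaves Q (Node s t)"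
    for p' q'
  proof -
    consider "card ({p'..<p' + width s} \<inter> S) < count_leaves Q s"
      | "card ({q'..<q' + width t} \<inter> S) < count_leaves Q t"
      | "card ({p'..<p' + width s} \<inter> S) \<le> count_leaves Q s" "card ({q'..<q' + width t} \<inter> S) \<le> count_leaves Q t"
      using le by fastforce
    then show ?thesis
    proof cases
      case 1
      have "lead x s p' = 0" "lead y s p' = 0"
        by (rule lead_eq_0[OF _ 1]; use zero in auto)+
      then show ?thesis by simp
    next
      case 2
      have "lead x t q' = 0" "lead y t q' = 0"
        by (rule lead_eq_0[OF _ 2]; use zero in auto)+
      then show ?thesis by simp
    next
      case 3
      have "lead x s p' = lead y s p'" "lead x t q' = lead y t q'"
        using Node.IH(1)[OF _ _ 3(1)] Node.IH(2)[OF _ _ 3(2)] Node.prems(1,2) by auto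
      then show ?thesis by simp
    qed
  qed
  show ?case
    using *[of p "p + width s"] *[of "p + width t" p] Node.prems(3)
      card_window_add[of p "width s" "width t" S] card_window_add[of p "width t" "width s" S]
    by (simp add: add.commute mult.commute)
qed

lemma lead_scale:
  assumes "\<And>l q. x l q = (if Q l then c * y l q else y l q)"
  shows "lead x t p = c ^ count_leaves Q t * lead y t p"
  by (induction t arbitrary: p) (auto simp: assms power_add algebra_simps)

lemma count_leaves_eq_0: "count_leaves ((=) l) t = 0 \<longleftrightarrow> l \<notin> set_comm_tree t"
  by (induction t) auto

lemma lead_linear:
  assumes "count_leaves ((=) l) t = 1"
  shows "lead (x(l := \<lambda>q. \<Sum>j \<in> J. c j * y j q)) t p = (\<Sum>j \<in> J. c j * lead (x(l := y j)) t p)"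
  using assms
proof (induction t arbitrary: p)
  case (Leaf l')
  then show ?case by (simp split: if_splits)
next
  case (Node s t)
  then consider "count_leaves ((=) l) s = 1" "l \<notin> set_comm_tree t"
    | "count_leaves ((=) l) t = 1" "l \<notin> set_comm_tree s"
    by (auto simp: count_leaves_eq_0[symmetric] add_is_1)
  then show ?case
  proof cases
    case 1
    then have t: "lead (x(l := U)) t q = lead x t q" for U q
      by (intro lead_cong) auto
    show ?thesis
      unfolding lead.simps t Node.IH(1)[OF 1(1)] sum_distrib_left sum_distrib_right
        sum_subtractf[symmetric]
      by (intro sum.cong HOL.refl) (simp only: algebra_simps)
  next
    case 2
    then have s: "lead (x(l := U)) s q = lead x s q" for U q
      by (intro lead_cong) auto
    show ?thesis
      unfolding lead.simps s Node.IH(2)[OF 2(1)] sum_distrib_left sum_distrib_right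
        sum_subtractf[symmetric]
      by (intro sum.cong HOL.refl) (simp only: algebra_simps)
  qed
qed

section \<open>Alternating sums\<close>

definition alt_lead :: "nat \<Rightarrow> (nat option \<Rightarrow> nat \<Rightarrow> int) \<Rightarrow> nat option comm_tree \<Rightarrow> int" where
  "alt_lead k x t = (\<Sum>\<sigma> | \<sigma> permutes {0..<k}. sign \<sigma> * lead (\<lambda>l. x (map_option \<sigma> l)) t 0)"

text \<open>Maps from I to {0..<k}, extended by the identity so that for I = {0..<k} the
  permutations are among them.\<close>

definition index_maps :: "nat set \<Rightarrow> nat \<Rightarrow> (nat \<Rightarrow> nat) set" where
  "index_maps I k = {\<tau>. (\<forall>i \<in> I. \<tau> i < k) \<and> (\<forall>i. i \<notin> I \<longrightarrow> \<tau> i = i)}"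

lemma index_maps_empty: "index_maps {} k = {id}"
  by (auto simp: index_maps_def)

lemma sum_index_maps_insert:
  fixes f :: "(nat \<Rightarrow> nat) \<Rightarrow> int"
  assumes "a \<notin> I"
  shows "(\<Sum>\<tau> \<in> index_maps (insert a I) k. f \<tau>) = (\<Sum>j<k. \<Sum>\<tau> \<in> index_maps I k. f (\<tau>(a := j)))"
proof -
  have "(\<Sum>(j, \<tau>) \<in> {..<k} \<times> index_maps I k. f (\<tau>(a := j))) = (\<Sum>\<tau> \<in> index_maps (insert a I) k. f \<tau>)"
    using assms
    by (intro sum.reindex_bij_witness[of _ "\<lambda>\<tau>. (\<tau> a, \<tau>(a := a))" "\<lambda>(j, \<tau>). \<tau>(a := j)"])
      (auto simp: index_maps_def fun_eq_iff)
  then show ?thesis by (simp add: sum.cartesian_product)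
qed

lemma finite_index_maps: "finite I \<Longrightarrow> finite (index_maps I k)"
proof (induction I rule: finite_induct)
  case (insert a I)
  have "index_maps (insert a I) k \<subseteq> (\<lambda>(j, \<tau>). \<tau>(a := j)) ` ({..<k} \<times> index_maps I k)"
  proof
    fix \<tau> assume "\<tau> \<in> index_maps (insert a I) k"
    then have "(\<tau> a, \<tau>(a := a)) \<in> {..<k} \<times> index_maps I k" "\<tau> = (\<tau>(a := a))(a := \<tau> a)"
      using insert.hyps by (auto simp: index_maps_def)
    then show "\<tau> \<in> (\<lambda>(j, \<tau>). \<tau>(a := j)) ` ({..<k} \<times> index_maps I k)"
      by (auto intro!: image_eqI[of _ _ "(\<tau> a, \<tau>(a := a))"])
  qed
  then show ?case
    using insert.IH by (meson finite_SigmaI finite_imageI finite_lessThan finite_subset)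
qed (simp add: index_maps_empty)

text \<open>Multilinearity in the leaves \<open>Some i\<close>, each occurring once, is applied one
  label at a time. Generalizing over z lets the induction store the value \<open>y j\<close> already
  chosen for a label.\<close>

lemma lead_expand:
  fixes c :: "nat \<Rightarrow> nat \<Rightarrow> int"
  assumes "finite I" and "\<And>i. i \<in> I \<Longrightarrow> count_leaves ((=) (Some i)) t = 1"
  shows "lead (case_option v (\<lambda>i. if i \<in> I then (\<lambda>q. \<Sum>j<k. c i j * y j q) else z i)) t p =
    (\<Sum>\<tau> \<in> index_maps I k. (\<Prod>i \<in> I. c i (\<tau> i)) *
      lead (case_option v (\<lambda>i. if i \<in> I then y (\<tau> i) else z i)) t p)"
  using assms
proof (induction I arbitrary: z rule: finite_induct)
  case empty
  then show ?case by (simp add: index_maps_empty)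
next
  case (insert a I)
  let ?L = "\<lambda>J z. case_option v (\<lambda>i. if i \<in> J then (\<lambda>q. \<Sum>j<k. c i j * y j q) else z i)"
  let ?R = "\<lambda>J \<tau> z. case_option v (\<lambda>i. if i \<in> J then y (\<tau> i) else z i)"
  have "?L (insert a I) z = (?L I z)(Some a := \<lambda>q. \<Sum>j<k. c a j * y j q)"
    by (auto simp: fun_eq_iff split: option.split)
  then have "lead (?L (insert a I) z) t p = (\<Sum>j<k. c a j * lead ((?L I z)(Some a := y j)) t p)"
    using insert.prems by (simp only: lead_linear insertI1)
  also have "\<dots> = (\<Sum>j<k. c a j * (\<Sum>\<tau> \<in> index_maps I k. (\<Prod>i \<in> I. c i (\<tau> i)) * lead (?R I \<tau> (z(a := y j))) t p))"
  proof (intro sum.cong HOL.refl)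
    fix j
    have "(?L I z)(Some a := y j) = ?L I (z(a := y j))"
      using insert.hyps by (auto simp: fun_eq_iff split: option.split)
    then show "c a j * lead ((?L I z)(Some a := y j)) t p =
      c a j * (\<Sum>\<tau> \<in> index_maps I k. (\<Prod>i \<in> I. c i (\<tau> i)) * lead (?R I \<tau> (z(a := y j))) t p)"
      using insert.IH[of "z(a := y j)"] insert.prems by simp
  qed
  also have "\<dots> = (\<Sum>j<k. \<Sum>\<tau> \<in> index_maps I k. (\<Prod>i \<in> insert a I. c i ((\<tau>(a := j)) i)) *
      lead (?R (insert a I) (\<tau>(a := j)) z) t p)"
    unfolding sum_distrib_left
  proof (intro sum.cong HOL.refl)
    fix j \<tau>
    have "?R I \<tau> (z(a := y j)) = ?R (insert a I) (\<tau>(a := j)) z"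
      using insert.hyps by (auto simp: fun_eq_iff split: option.split)
    moreover have "(\<Prod>i \<in> insert a I. c i ((\<tau>(a := j)) i)) = c a j * (\<Prod>i \<in> I. c i (\<tau> i))"
      using insert.hyps by (auto intro!: prod.cong)
    ultimately show "c a j * ((\<Prod>i \<in> I. c i (\<tau> i)) * lead (?R I \<tau> (z(a := y j))) t p) =
      (\<Prod>i \<in> insert a I. c i ((\<tau>(a := j)) i)) * lead (?R (insert a I) (\<tau>(a := j)) z) t p"
      by simp
  qed
  also have "\<dots> = (\<Sum>\<tau> \<in> index_maps (insert a I) k. (\<Prod>i \<in> insert a I. c i (\<tau> i)) *
      lead (?R (insert a I) \<tau> z) t p)"
    by (rule sum_index_maps_insert[OF insert.hyps(2), symmetric])
  finally show ?case .
qed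

text \<open>A selection that is not a permutation repeats a column; a permutation only changes the
  sign.\<close>

lemma det_select_columns:
  fixes P :: "nat \<Rightarrow> nat \<Rightarrow> int"
  assumes \<tau>: "\<tau> \<in> index_maps {0..<k} k"
  shows "det (mat k k (\<lambda>(i, j). P i (\<tau> j))) =
    (if \<tau> permutes {0..<k} then sign \<tau> * det (mat k k (\<lambda>(i, j). P i j)) else 0)"
proof -
  let ?B = "mat k k (\<lambda>(i, j). P i (\<tau> j))" and ?B' = "mat k k (\<lambda>(i, j). P j (\<tau> i))"
  let ?A = "mat k k (\<lambda>(i, j). P i j)" and ?A' = "mat k k (\<lambda>(i, j). P j i)"
  have "?B' = transpose_mat ?B" "?A' = transpose_mat ?A" by auto
  then have det: "det ?B' = det ?B" "det ?A' = det ?A"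
    using det_transpose[of ?B k] det_transpose[of ?A k] by simp_all
  show ?thesis
  proof (cases "\<tau> permutes {0..<k}")
    case True
    have "mat k k (\<lambda>(i, j). ?A' $$ (\<tau> i, j)) = ?B'"
      using \<tau> by (auto simp: index_maps_def)
    then have "det ?B' = sign \<tau> * det ?A'"
      using det_permute_rows[of ?A' k \<tau>] True by simp
    then show ?thesis using True det by simp
  next
    case False
    have "\<not> inj_on \<tau> {0..<k}"
    proof
      assume inj: "inj_on \<tau> {0..<k}"
      moreover have "\<tau> ` {0..<k} \<subseteq> {0..<k}" using \<tau> by (auto simp: index_maps_def)
      ultimately have "bij_betw \<tau> {0..<k} {0..<k}"
        by (simp add: bij_betw_def endo_inj_surj)
      then have "\<tau> permutes {0..<k}"
        using \<tau> by (intro bij_imp_permutes) (auto simp: index_maps_def)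
      with False show False ..
    qed
    then obtain i j where ij: "i \<noteq> j" "i < k" "j < k" "\<tau> i = \<tau> j"
      by (auto simp: inj_on_def)
    then have "row ?B' i = row ?B' j" by (auto simp: row_def)
    then have "det ?B' = 0"
      using det_identical_rows[of ?B' k i j] ij by auto
    then show ?thesis using False det by simp
  qed
qed

text \<open>After multilinear expansion, the sum over \<sigma> for a fixed selection \<tau> is the
  determinant of P with columns selected by \<tau>. Only permutations survive, and their signs
  rebuild the alternating sum for y.\<close>

lemma alt_lead_linear:
  assumes count: "\<And>i. i < k \<Longrightarrow> count_leaves ((=) (Some i)) t = 1"
    and leaves: "\<And>i. Some i \<in> set_comm_tree t \<Longrightarrow> i < k"
    and x: "\<And>i q. i < k \<Longrightarrow> x (Some i) q = (\<Sum>j<k. P i j * y (Some j) q)" and None: "x None = y None"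
  shows "alt_lead k x t = det (mat k k (\<lambda>(i, j). P i j)) * alt_lead k y t"
proof -
  let ?F = "index_maps {0..<k} k"
  let ?L = "\<lambda>\<tau>. lead (\<lambda>l. y (map_option \<tau> l)) t 0"
  have expand: "lead (\<lambda>l. x (map_option \<sigma> l)) t 0 = (\<Sum>\<tau> \<in> ?F. (\<Prod>i \<in> {0..<k}. P (\<sigma> i) (\<tau> i)) * ?L \<tau>)"
    if \<sigma>: "\<sigma> permutes {0..<k}" for \<sigma>
  proof -
    have \<sigma>k: "\<sigma> i < k" if "i < k" for i
      using permutes_in_image[OF \<sigma>, of i] that by simp
    have "lead (\<lambda>l. x (map_option \<sigma> l)) t 0 =
      lead (case_option (y None) (\<lambda>i. if i \<in> {0..<k} then (\<lambda>q. \<Sum>j<k. P (\<sigma> i) j * y (Some j) q) else (\<lambda>_. 0))) t 0"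
      using leaves by (intro lead_cong) (auto simp: None fun_eq_iff x \<sigma>k split: option.split)
    also have "\<dots> = (\<Sum>\<tau> \<in> ?F. (\<Prod>i \<in> {0..<k}. P (\<sigma> i) (\<tau> i)) *
        lead (case_option (y None) (\<lambda>i. if i \<in> {0..<k} then y (Some (\<tau> i)) else (\<lambda>_. 0))) t 0)"
      by (rule lead_expand) (auto simp: count)
    also have "\<dots> = (\<Sum>\<tau> \<in> ?F. (\<Prod>i \<in> {0..<k}. P (\<sigma> i) (\<tau> i)) * ?L \<tau>)"
      using leaves by (intro sum.cong arg_cong2[where f = times] HOL.refl lead_cong) (auto split: option.split)
    finally show ?thesis .
  qed
  have "alt_lead k x t = (\<Sum>\<sigma> | \<sigma> permutes {0..<k}. \<Sum>\<tau> \<in> ?F. ?L \<tau> * (sign \<sigma> * (\<Prod>i \<in> {0..<k}. P (\<sigma> i) (\<tau> i))))"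
    unfolding alt_lead_def
    by (intro sum.cong HOL.refl) (simp only: mem_Collect_eq expand sum_distrib_left mult_ac)
  also have "\<dots> = (\<Sum>\<tau> \<in> ?F. ?L \<tau> * (\<Sum>\<sigma> | \<sigma> permutes {0..<k}. sign \<sigma> * (\<Prod>i \<in> {0..<k}. P (\<sigma> i) (\<tau> i))))"
    unfolding sum_distrib_left by (rule sum.swap)
  also have "\<dots> = (\<Sum>\<tau> \<in> ?F. ?L \<tau> * det (mat k k (\<lambda>(i, j). P i (\<tau> j))))"
  proof (intro sum.cong HOL.refl arg_cong2[where f = times])
    fix \<tau>
    have "(\<Prod>i \<in> {0..<k}. P (\<sigma> i) (\<tau> i)) = (\<Prod>j<k. mat k k (\<lambda>(i, j). P i (\<tau> j)) $$ (\<sigma> j, j))"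
      if "\<sigma> permutes {0..<k}" for \<sigma>
    proof (rule prod.cong)
      fix j assume "j \<in> {..<k}"
      then have "j < k" "\<sigma> j < k"
        using permutes_in_image[OF that, of j] by simp_all
      then show "P (\<sigma> j) (\<tau> j) = mat k k (\<lambda>(i, j). P i (\<tau> j)) $$ (\<sigma> j, j)"
        by simp
    qed (rule atLeast0LessThan)
    then show "(\<Sum>\<sigma> | \<sigma> permutes {0..<k}. sign \<sigma> * (\<Prod>i \<in> {0..<k}. P (\<sigma> i) (\<tau> i))) =
        det (mat k k (\<lambda>(i, j). P i (\<tau> j)))"
      by (subst det_col[of _ k]) (auto intro!: sum.cong)
  qed
  also have "\<dots> = (\<Sum>\<tau> \<in> ?F. if \<tau> permutes {0..<k} then ?L \<tau> * (sign \<tau> * det (mat k k (\<lambda>(i, j). P i j))) else 0)"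
    by (intro sum.cong HOL.refl) (simp add: det_select_columns)
  also have "\<dots> = (\<Sum>\<tau> | \<tau> permutes {0..<k}. ?L \<tau> * (sign \<tau> * det (mat k k (\<lambda>(i, j). P i j))))"
  proof -
    have "{\<tau>. \<tau> permutes {0..<k}} \<subseteq> ?F"
    proof
      fix \<tau> assume "\<tau> \<in> {\<tau>. \<tau> permutes {0..<k}}"
      then show "\<tau> \<in> ?F"
        using permutes_in_image[of \<tau> "{0..<k}"] permutes_not_in[of \<tau> "{0..<k}"]
        by (auto simp: index_maps_def)
    qed
    then show ?thesis
      by (intro sum.mono_neutral_cong_right) (auto simp: finite_index_maps)
  qed
  finally show ?thesis
    unfolding alt_lead_def sum_distrib_left by (simp only: mult_ac)
qed

text \<open>The leaf \<open>None\<close> stands for v1 and \<open>Some i\<close> for \<open>w_i\<close>; the inner bracket is the iterated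
  commutator of \<open>w_i\<close> with v1.  The innermost exponent e is smaller than the exponents 2e of all
  other blocks, so that only the identity permutation contributes the word \<open>nest_word\<close>, and the
  total exponent has the parity of e.\<close>
primrec ad_tree :: "nat \<Rightarrow> nat \<Rightarrow> nat option comm_tree" where
  "ad_tree 0 i = Leaf (Some i)"
| "ad_tree (Suc a) i = Node (Leaf None) (ad_tree a i)"

primrec nest_tree :: "nat \<Rightarrow> nat \<Rightarrow> nat \<Rightarrow> nat option comm_tree" where
  "nest_tree e 0 i = ad_tree e i"
| "nest_tree e (Suc n) i = Node (ad_tree (2 * e) i) (nest_tree e n (Suc i))"

primrec nest_word :: "nat \<Rightarrow> nat \<Rightarrow> nat \<Rightarrow> nat option list" where
  "nest_word e 0 i = replicate e None @ [Some i]"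
| "nest_word e (Suc n) i = replicate (2 * e) None @ Some i # nest_word e n (Suc i)"

lemma width_ad_tree [simp]: "width (ad_tree a i) = Suc a"
  by (induction a) auto

lemma width_nest_tree: "width (nest_tree e n i) = length (nest_word e n i)"
  by (induction n arbitrary: i) auto

lemma count_ad_tree: "count_leaves Q (ad_tree a i) = (if Q None then a else 0) + (if Q (Some i) then 1 else 0)"
  by (induction a) auto

lemma count_nest_tree_None: "count_leaves (\<lambda>l. l = None) (nest_tree e n i) = 2 * e * n + e"
  by (induction n arbitrary: i) (auto simp: count_ad_tree)

lemma count_nest_tree_not_None: "count_leaves (\<lambda>l. l \<noteq> None) (nest_tree e n i) = Suc n"
  by (induction n arbitrary: i) (auto simp: count_ad_tree)

lemma count_nest_tree_Some:
  "count_leaves ((=) (Some j)) (nest_tree e n i) = (if i \<le> j \<and> j \<le> i + n then 1 else 0)"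
  by (induction n arbitrary: i) (auto simp: count_ad_tree)

lemma Some_in_nest_tree: "Some j \<in> set_comm_tree (nest_tree e n i) \<longleftrightarrow> i \<le> j \<and> j \<le> i + n"
  using count_leaves_eq_0[of "Some j" "nest_tree e n i"] by (auto simp: count_nest_tree_Some split: if_splits)

text \<open>This exhibits two letters other than \<open>None\<close> among the last e + 2, as needed
  in \<open>lead_nest_tree_word\<close>.\<close>

lemma nest_word_last:
  "\<exists>u j j'. nest_word e (Suc n) i = u @ Some j # replicate e None @ [Some j']"
proof (induction n arbitrary: i)
  case 0
  then show ?case by auto
next
  case (Suc n)
  then obtain u j j' where "nest_word e (Suc n) (Suc i) = u @ Some j # replicate e None @ [Some j']"
    by blast
  then show ?case
    by (intro exI[of _ "replicate (2 * e) None @ Some i # u"] exI[of _ j] exI[of _ j']) simp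
qed

text \<open>With these superdiagonals, \<open>lead\<close> at position 0 of a tree whose width is
  the length of w is the coefficient of w in the associative expansion of that Lie monomial.\<close>

definition word_coeff :: "'l list \<Rightarrow> 'l \<Rightarrow> nat \<Rightarrow> int" where
  "word_coeff w l p = (if p < length w \<and> w ! p = l then 1 else 0)"

lemma lead_ad_tree_word:
  assumes "w = u @ replicate a None @ Some j # u'"
  shows "lead (\<lambda>l. word_coeff w (map_option \<sigma> l)) (ad_tree a i) (length u) = (if \<sigma> i = j then 1 else 0)"
  using assms
proof (induction a arbitrary: u)
  case 0
  then show ?case by (auto simp: word_coeff_def)
next
  case (Suc a)
  have "word_coeff w None (length u) = 1"
    using Suc.prems by (simp add: word_coeff_def)
  \<comment> \<open>The opposite term of the bracket would need \<open>None\<close> at the last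
    letter of the block.\<close>
  moreover have "w ! (length u + Suc a) = Some j"
    using Suc.prems by (simp add: nth_append)
  then have "word_coeff w None (length u + Suc a) = 0"
    by (simp add: word_coeff_def)
  moreover have "lead (\<lambda>l. word_coeff w (map_option \<sigma> l)) (ad_tree a i) (length u + 1) = (if \<sigma> i = j then 1 else 0)"
    using Suc.IH[of "u @ [None]"] Suc.prems by simp
  ultimately show ?case by simp
qed

text \<open>The term in the written order requires that \<sigma> fixes i and passes to the rest of
  the word. In the opposite term the outer block reads the last 2e + 1 letters, which contain at
  most 2e - 1 letters \<open>None\<close>, too few for its 2e leaves.\<close>

lemma lead_nest_tree_word:
  assumes e: "e > 0" and w: "w = u @ nest_word e n i"
  shows "lead (\<lambda>l. word_coeff w (map_option \<sigma> l)) (nest_tree e n i) (length u) =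
    (if \<forall>j \<in> {i..i + n}. \<sigma> j = j then 1 else 0)"
  using w
proof (induction n arbitrary: u i)
  case 0
  then show ?case using lead_ad_tree_word[of w u e i "[]"] by simp
next
  case (Suc n)
  let ?x = "\<lambda>l. word_coeff w (map_option \<sigma> l)"
  let ?v = "nest_word e n (Suc i)"
  have w: "w = u @ replicate (2 * e) None @ Some i # ?v" using Suc.prems by simp
  have first: "lead ?x (ad_tree (2 * e) i) (length u) = (if \<sigma> i = i then 1 else 0)"
    by (rule lead_ad_tree_word[OF w])
  have rest: "lead ?x (nest_tree e n (Suc i)) (length u + Suc (2 * e)) =
      (if \<forall>j \<in> {Suc i..Suc i + n}. \<sigma> j = j then 1 else 0)"
    using Suc.IH[of "u @ replicate (2 * e) None @ [Some i]" "Suc i"] w by simp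
  have "lead ?x (ad_tree (2 * e) i) (length u + length ?v) = 0"
  proof (rule lead_eq_0[where Q = "\<lambda>l. l = None" and S = "{q. q < length w \<and> w ! q = None}"])
    obtain s j j' where s: "nest_word e (Suc n) i = s @ Some j # replicate e None @ [Some j']"
      using nest_word_last by blast
    let ?a = "length u + length s"
    have ws: "w = (u @ s) @ Some j # replicate e None @ [Some j']" using Suc.prems s by simp
    have len: "length w = ?a + e + 2" "length w = length u + length ?v + 2 * e + 1"
      using ws arg_cong[OF w, of length] by simp_all
    have "w ! ?a = Some j" unfolding ws by (metis length_append nth_append_length)
    moreover have "w ! (?a + e + 1) = Some j'" unfolding ws by (simp add: nth_append)
    ultimately have sub: "{length u + length ?v..<length u + length ?v + width (ad_tree (2 * e) i)} \<inter>
        {q. q < length w \<and> w ! q = None} \<subseteq> {length u + length ?v..<length w} - {?a, ?a + e + 1}"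
      using len by auto
    have "card ({length u + length ?v..<length w} - {?a, ?a + e + 1}) = 2 * e + 1 - 2"
      using len e by (subst card_Diff_subset) auto
    then show "card ({length u + length ?v..<length u + length ?v + width (ad_tree (2 * e) i)} \<inter>
        {q. q < length w \<and> w ! q = None}) < count_leaves (\<lambda>l. l = None) (ad_tree (2 * e) i)"
      using card_mono[OF _ sub] e by (simp add: count_ad_tree)
  qed (auto simp: word_coeff_def)
  moreover have "{i..i + Suc n} = insert i {Suc i..Suc i + n}" by auto
  ultimately show ?case
    using first rest by (simp add: width_nest_tree del: atLeastAtMost_iff)
qed

lemma alt_lead_word:
  assumes "e > 0"
  shows "alt_lead (Suc n) (word_coeff (nest_word e n 0)) (nest_tree e n 0) = 1"
proof -
  have "lead (\<lambda>l. word_coeff (nest_word e n 0) (map_option \<sigma> l)) (nest_tree e n 0) 0 = (if \<sigma> = id then 1 else 0)"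
    if "\<sigma> permutes {0..<Suc n}" for \<sigma>
  proof -
    have "(\<forall>j \<in> {0..0 + n}. \<sigma> j = j) \<longleftrightarrow> \<sigma> = id"
      using permutes_not_in[OF that] by (fastforce simp: fun_eq_iff)
    then show ?thesis
      using lead_nest_tree_word[OF assms, of "nest_word e n 0" "[]" n 0 \<sigma>] by simp
  qed
  then have "alt_lead (Suc n) (word_coeff (nest_word e n 0)) (nest_tree e n 0) =
      (\<Sum>\<sigma> | \<sigma> permutes {0..<Suc n}. if \<sigma> = id then 1 else 0)"
    unfolding alt_lead_def by (intro sum.cong HOL.refl) auto
  then show ?thesis
    by (simp add: finite_permutations permutes_id)
qed

text \<open>In nonzero terms the n + 1 leaves \<open>Some\<close> fill the positions of W, so the
  values of \<open>None\<close> on W do not affect the result and may be replaced by c times those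
  of y. Each of the 2en + e leaves \<open>None\<close> then gives a factor c, and the leaves
  \<open>Some\<close> give the determinant.\<close>

lemma alt_lead_transform:
  assumes x: "\<And>i q. i \<le> n \<Longrightarrow> x (Some i) q = (\<Sum>j<Suc n. P i j * y (Some j) q)"
    and y: "\<And>j q. j \<le> n \<Longrightarrow> q \<notin> W \<Longrightarrow> y (Some j) q = 0"
    and None: "\<And>q. q \<notin> W \<Longrightarrow> x None q = c * y None q"
    and W: "card ({0..<width (nest_tree e n 0)} \<inter> W) \<le> Suc n"
  shows "alt_lead (Suc n) x (nest_tree e n 0) =
    c ^ (2 * e * n + e) * det (mat (Suc n) (Suc n) (\<lambda>(i, j). P i j)) * alt_lead (Suc n) y (nest_tree e n 0)"
proof -
  let ?t = "nest_tree e n 0"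
  let ?x1 = "case_option (\<lambda>q. c * y None q) (\<lambda>i. x (Some i))"
  let ?x2 = "case_option (y None) (\<lambda>i. x (Some i))"
  have x0: "x (Some i) q = 0" if "i \<le> n" "q \<notin> W" for i q
    using that by (simp add: x y del: sum.lessThan_Suc)
  have "lead (\<lambda>l. x (map_option \<sigma> l)) ?t 0 = lead (\<lambda>l. ?x1 (map_option \<sigma> l)) ?t 0"
    if "\<sigma> permutes {0..<Suc n}" for \<sigma>
  proof (rule lead_eq_if_agree[where Q = "\<lambda>l. l \<noteq> None" and S = W])
    show "x (map_option \<sigma> l) q = 0" if "l \<in> set_comm_tree ?t" "l \<noteq> None" "q \<notin> W" for l q
      using that permutes_in_image[OF \<open>\<sigma> permutes {0..<Suc n}\<close>]
      by (auto simp: Some_in_nest_tree x0 less_Suc_eq_le)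
    show "x (map_option \<sigma> l) q = ?x1 (map_option \<sigma> l) q"
      if "l \<in> set_comm_tree ?t" "l \<noteq> None \<or> q \<notin> W" for l q
      using that(2) by (cases l rule: option.exhaust) (auto simp: None)
  qed (use W in \<open>simp only: count_nest_tree_not_None add_0\<close>)
  then have "alt_lead (Suc n) x ?t = alt_lead (Suc n) ?x1 ?t"
    unfolding alt_lead_def by (intro sum.cong HOL.refl) auto
  moreover have "lead (\<lambda>l. ?x1 (map_option \<sigma> l)) ?t 0 = c ^ (2 * e * n + e) * lead (\<lambda>l. ?x2 (map_option \<sigma> l)) ?t 0" for \<sigma>
    unfolding count_nest_tree_None[of e n 0, symmetric] by (rule lead_scale) (auto split: option.split)
  then have "alt_lead (Suc n) ?x1 ?t = c ^ (2 * e * n + e) * alt_lead (Suc n) ?x2 ?t"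
    unfolding alt_lead_def sum_distrib_left by (intro sum.cong HOL.refl) (simp only: mult_ac)
  moreover have "alt_lead (Suc n) ?x2 ?t = det (mat (Suc n) (Suc n) (\<lambda>(i, j). P i j)) * alt_lead (Suc n) y ?t"
    by (rule alt_lead_linear) (auto simp: count_nest_tree_Some Some_in_nest_tree x simp del: sum.lessThan_Suc)
  ultimately show ?thesis by simp
qed

section \<open>Group elements that realise alternating sums\<close>

lemma (in group) unirep_inv_lead:
  assumes \<rho>: "unirep G \<rho>" and c: "c > 0" and g: "g \<in> carrier G" "depth_ge c (\<rho> g - 1)"
  shows "depth_ge c (\<rho> (inv g) - 1)" and "ent (\<rho> (inv g)) 0 c = - ent (\<rho> g) 0 c"
proof -
  have "\<rho> g * \<rho> (inv g) = 1"
    using unirepD(2)[OF \<rho> g(1), of "inv g"] unirepD(1)[OF \<rho>] g by simp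
  then have eq: "\<rho> (inv g) - 1 = 0 - ((\<rho> g - 1) + (\<rho> g - 1) * (\<rho> (inv g) - 1))"
    by (simp add: algebra_simps)
  have "depth_ge (c + 1) ((\<rho> g - 1) * (\<rho> (inv g) - 1))"
    using g unirepD(3)[OF \<rho>, of "inv g"] by (intro depth_ge_mult) auto
  then have "depth_ge c ((\<rho> g - 1) * (\<rho> (inv g) - 1))"
    by (rule depth_ge_mono) simp
  then show d: "depth_ge c (\<rho> (inv g) - 1)"
    by (subst eq) (intro depth_ge_diff depth_ge_add depth_ge_zero g(2))
  show "ent (\<rho> (inv g)) 0 c = - ent (\<rho> g) 0 c"
    using unirep_mult_lead(2)[OF \<rho> c g inv_closed[OF g(1)] d] unirepD(1)[OF \<rho>] g c by simp
qed

text \<open>At depth c corner entries add under products and change sign under inversion. The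
  element y is chosen before \<rho>, so it serves all representations at once.\<close>

lemma (in group) exists_signed_product:
  assumes "finite I" and z: "\<And>i. i \<in> I \<Longrightarrow> z i \<in> carrier G" and c: "c > 0"
    and s: "\<And>i. i \<in> I \<Longrightarrow> s i = 1 \<or> s i = (- 1 :: int)"
  shows "\<exists>y \<in> carrier G. \<forall>\<rho>. unirep G \<rho> \<longrightarrow> (\<forall>i \<in> I. depth_ge c (\<rho> (z i) - 1)) \<longrightarrow>
    depth_ge c (\<rho> y - 1) \<and> ent (\<rho> y) 0 c = (\<Sum>i \<in> I. s i * ent (\<rho> (z i)) 0 c)"
  using assms(1) z s
proof (induction I rule: finite_induct)
  case empty
  then show ?case using c by (intro bexI[of _ \<one>]) (auto simp: unirepD)
next
  case (insert a I)
  then obtain y where y: "y \<in> carrier G"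
    "\<And>\<rho>. unirep G \<rho> \<Longrightarrow> (\<forall>i \<in> I. depth_ge c (\<rho> (z i) - 1)) \<Longrightarrow>
      depth_ge c (\<rho> y - 1) \<and> ent (\<rho> y) 0 c = (\<Sum>i \<in> I. s i * ent (\<rho> (z i)) 0 c)"
    by auto
  define za where "za = (if s a = 1 then z a else inv (z a))"
  have za: "za \<in> carrier G" using insert.prems by (simp add: za_def)
  have za_lead: "depth_ge c (\<rho> za - 1) \<and> ent (\<rho> za) 0 c = s a * ent (\<rho> (z a)) 0 c"
    if "unirep G \<rho>" "depth_ge c (\<rho> (z a) - 1)" for \<rho>
    using unirep_inv_lead[OF that(1) c insert.prems(1)[of a] that(2)] insert.prems(2)[of a] that(2)
    by (auto simp: za_def)
  show ?case
  proof (intro bexI[of _ "za \<otimes> y"] allI impI)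
    fix \<rho> assume \<rho>: "unirep G \<rho>" and d: "\<forall>i \<in> insert a I. depth_ge c (\<rho> (z i) - 1)"
    then show "depth_ge c (\<rho> (za \<otimes> y) - 1) \<and>
        ent (\<rho> (za \<otimes> y)) 0 c = (\<Sum>i \<in> insert a I. s i * ent (\<rho> (z i)) 0 c)"
      using unirep_mult_lead[OF \<rho> c za _ y(1)] za_lead[OF \<rho>] y(2)[OF \<rho>] insert.hyps by simp
  qed (use za y in simp)
qed

lemma (in group) exists_alt_element:
  assumes g: "\<And>l. l \<in> set_comm_tree t \<Longrightarrow> l \<noteq> None \<longrightarrow> the l < k" and cl: "g None \<in> carrier G"
    "\<And>i. i < k \<Longrightarrow> g (Some i) \<in> carrier G"
  shows "\<exists>z \<in> carrier G. \<forall>\<rho>. unirep G \<rho> \<longrightarrow> depth_ge (width t) (\<rho> z - 1) \<and>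
    ent (\<rho> z) 0 (width t) = alt_lead k (\<lambda>l p. ent (\<rho> (g l)) p (Suc p)) t"
proof -
  have cl': "g (map_option \<sigma> l) \<in> carrier G" if "\<sigma> permutes {0..<k}" "l \<in> set_comm_tree t" for \<sigma> l
    using cl g[OF that(2)] permutes_in_image[OF that(1), of "the l"]
    by (cases l rule: option.exhaust) auto
  let ?z = "\<lambda>\<sigma>. comm_eval G (\<lambda>l. g (map_option \<sigma> l)) t"
  have "\<exists>z \<in> carrier G. \<forall>\<rho>. unirep G \<rho> \<longrightarrow>
      (\<forall>\<sigma> \<in> {\<sigma>. \<sigma> permutes {0..<k}}. depth_ge (width t) (\<rho> (?z \<sigma>) - 1)) \<longrightarrow>
      depth_ge (width t) (\<rho> z - 1) \<and>
      ent (\<rho> z) 0 (width t) = (\<Sum>\<sigma> | \<sigma> permutes {0..<k}. sign \<sigma> * ent (\<rho> (?z \<sigma>)) 0 (width t))"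
    by (rule exists_signed_product) (auto simp: finite_permutations cl' sign_def intro!: comm_eval_closed gr0I)
  then obtain z where z: "z \<in> carrier G" and lead: "\<And>\<rho>. unirep G \<rho> \<Longrightarrow>
      \<forall>\<sigma> \<in> {\<sigma>. \<sigma> permutes {0..<k}}. depth_ge (width t) (\<rho> (?z \<sigma>) - 1) \<Longrightarrow>
      depth_ge (width t) (\<rho> z - 1) \<and>
      ent (\<rho> z) 0 (width t) = (\<Sum>\<sigma> | \<sigma> permutes {0..<k}. sign \<sigma> * ent (\<rho> (?z \<sigma>)) 0 (width t))"
    by blast
  show ?thesis
  proof (intro bexI[OF _ z] allI impI)
    fix \<rho> assume \<rho>: "unirep G \<rho>"
    have "depth_ge (width t) (\<rho> (?z \<sigma>) - 1)"
      and "ent (\<rho> (?z \<sigma>)) 0 (width t) = lead (\<lambda>l p. ent (\<rho> (g (map_option \<sigma> l))) p (Suc p)) t 0"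
      if "\<sigma> permutes {0..<k}" for \<sigma>
      using unirep_comm_eval(1)[OF \<rho>, of t "\<lambda>l. g (map_option \<sigma> l)"] cl'[OF that]
        unirep_comm_eval(2)[OF \<rho>, of t "\<lambda>l. g (map_option \<sigma> l)" 0] by simp_all
    then show "depth_ge (width t) (\<rho> z - 1) \<and>
        ent (\<rho> z) 0 (width t) = alt_lead k (\<lambda>l p. ent (\<rho> (g l)) p (Suc p)) t"
      using lead[OF \<rho>] by (simp add: alt_lead_def)
  qed
qed

lemma card_nest_word_Some:
  "card {p. p < length (nest_word e n i) \<and> nest_word e n i ! p \<noteq> None} = Suc n"
proof -
  have "length (filter (\<lambda>l. l \<noteq> None) (nest_word e n i)) = Suc n"
    by (induction n arbitrary: i) (auto simp: filter_replicate)
  then show ?thesis by (simp add: length_filter_conv_card)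
qed

lemma Some_in_nest_word: "Some j \<in> set (nest_word e n i) \<Longrightarrow> j \<le> i + n"
  by (induction n arbitrary: i) (force simp: set_replicate_conv_if split: if_splits)+

text \<open>Some of the w_i may be adjacent to each other; the blocks of \<open>None\<close> keep
  them apart, so that a representation can read the word without commuting letters at consecutive
  positions.\<close>

lemma nest_word_separated:
  assumes "e > 0" "Suc p < length (nest_word e n i)"
  shows "nest_word e n i ! p = None \<or> nest_word e n i ! Suc p = None"
proof -
  let ?P = "\<lambda>l l'. l = None \<or> l' = None"
  have rep: "successively ?P (replicate m None)" for m
    by (induction m) (auto simp: successively_Cons)
  \<comment> \<open>The head \<open>None\<close> is carried along because every block ends in a
    \<open>Some\<close> that the next block must follow.\<close>
  have "nest_word e n i \<noteq> [] \<and> hd (nest_word e n i) = None \<and> successively ?P (nest_word e n i)"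
    using assms(1) by (induction n arbitrary: i)
      (auto simp: successively_append_iff successively_Cons rep hd_append)
  then show ?thesis
    using assms(2) by (simp add: successively_conv_nth)
qed

section \<open>The fixed central element\<close>

definition slots :: "nat \<Rightarrow> nat \<Rightarrow> nat set" where
  "slots e n = {p. p < length (nest_word e n 0) \<and> nest_word e n 0 ! p \<noteq> None}"

context split_aut
begin

definition slot_reps :: "nat set \<Rightarrow> ('v word set \<Rightarrow> tri) set" where
  "slot_reps W = {\<rho>. unirep (raag G) \<rho> \<and>
     (\<forall>u \<in> pverts G - {v1, v2}. \<forall>p. p \<notin> W \<longrightarrow> ent (\<rho> (gen G u)) p (Suc p) = 0)}"

definition letter :: "'v \<Rightarrow> (nat \<Rightarrow> 'v) \<Rightarrow> nat option \<Rightarrow> 'v word set" where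
  "letter v w l = gen G (case_option v w l)"

lemma unirep_phi: "unirep (raag G) \<rho> \<Longrightarrow> unirep (raag G) (\<lambda>g. \<rho> (\<phi> g))"
  using hom_one[OF phi group_raag group_raag]
  by (auto simp: unirep_def hom_mult[OF phi] phi_closed)

lemma ent_phi_gen:
  assumes "unirep (raag G) \<rho>" "a \<in> pverts G"
  shows "ent (\<rho> (\<phi> (gen G a))) p (Suc p) = (\<Sum>b \<in> pverts G. M a b * ent (\<rho> (gen G b)) p (Suc p))"
  by (rule additive_phi_gen[OF additive_on_ent[OF assms(1)] assms(2)])

text \<open>The image of a vertex other than v1, v2 has no exponent at v1 or v2, so its
  superdiagonal combines entries that vanish outside W.\<close>

lemma slot_reps_phi:
  assumes "\<rho> \<in> slot_reps W"
  shows "(\<lambda>g. \<rho> (\<phi> g)) \<in> slot_reps W"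
proof -
  have \<rho>: "unirep (raag G) \<rho>" using assms by (simp add: slot_reps_def)
  have "ent (\<rho> (\<phi> (gen G u))) p (Suc p) = 0" if u: "u \<in> pverts G - {v1, v2}" and p: "p \<notin> W" for u p
  proof -
    have "M u b * ent (\<rho> (gen G b)) p (Suc p) = 0" if "b \<in> pverts G" for b
      using assms p that M_other_v1[OF u] M_other_v2[OF u] by (cases "b \<in> {v1, v2}") (auto simp: slot_reps_def)
    then show ?thesis using ent_phi_gen[OF \<rho>, of u p] u by (simp del: mult_eq_0_iff)
  qed
  then show ?thesis
    using unirep_phi[OF \<rho>] by (simp add: slot_reps_def)
qed

lemma exists_lie_element:
  assumes v: "v \<in> pverts G" and w: "\<And>i. i \<le> n \<Longrightarrow> w i \<in> pverts G"
  shows "\<exists>z \<in> carrier (raag G). \<forall>\<rho>. unirep (raag G) \<rho> \<longrightarrow>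
    depth_ge (width (nest_tree e n 0)) (\<rho> z - 1) \<and> ent (\<rho> z) 0 (width (nest_tree e n 0)) =
      alt_lead (Suc n) (\<lambda>l p. ent (\<rho> (letter v w l)) p (Suc p)) (nest_tree e n 0)"
proof -
  interpret group "raag G" by (rule group_raag)
  show ?thesis
  proof (rule exists_alt_element)
    show "l \<noteq> None \<longrightarrow> the l < Suc n" if "l \<in> set_comm_tree (nest_tree e n 0)" for l
      using that by (auto simp: Some_in_nest_tree)
  qed (use v w in \<open>auto simp: letter_def gen_closed\<close>)
qed

text \<open>Only the image of v modulo the other vertices matters: a product of c superdiagonal entries
  that uses another vertex in place of a v has more factors from outside \<open>{v1, v2}\<close> than there
  are slots.\<close>
lemma alt_lead_phi:
  assumes \<rho>: "\<rho> \<in> slot_reps (slots e n)"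
    and v: "v \<in> {v1, v2}" and v': "v' \<in> {v1, v2}" "\<And>u. u \<in> {v1, v2} \<Longrightarrow> u \<noteq> v' \<Longrightarrow> M v u = 0"
    and w: "\<And>i. i \<le> n \<Longrightarrow> w i \<in> pverts G"
    and w': "bij_betw w' {..<Suc n} B" "B \<subseteq> pverts G - {v1, v2}"
    and supp: "\<And>i b. i \<le> n \<Longrightarrow> b \<in> pverts G - B \<Longrightarrow> M (w i) b = 0"
  shows "alt_lead (Suc n) (\<lambda>l p. ent (\<rho> (\<phi> (letter v w l))) p (Suc p)) (nest_tree e n 0) =
    M v v' ^ (2 * e * n + e) * det (mat (Suc n) (Suc n) (\<lambda>(i, j). M (w i) (w' j))) *
    alt_lead (Suc n) (\<lambda>l p. ent (\<rho> (letter v' w' l)) p (Suc p)) (nest_tree e n 0)"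
proof (rule alt_lead_transform)
  have slot: "ent (\<rho> (gen G u)) p (Suc p) = 0"
    if "u \<in> pverts G - {v1, v2}" "p \<notin> slots e n" for u p
    using \<rho> that by (auto simp: slot_reps_def)
  have rep: "unirep (raag G) \<rho>" using \<rho> by (simp add: slot_reps_def)
  show "ent (\<rho> (\<phi> (letter v w (Some i)))) q (Suc q) =
      (\<Sum>j<Suc n. M (w i) (w' j) * ent (\<rho> (letter v' w' (Some j))) q (Suc q))" if i: "i \<le> n" for i q
  proof -
    have "ent (\<rho> (\<phi> (letter v w (Some i)))) q (Suc q) =
        (\<Sum>b \<in> B. M (w i) b * ent (\<rho> (gen G b)) q (Suc q))"
      using w[OF i] w'(2) supp[OF i] pair_finite_verts
      by (simp only: letter_def option.case ent_phi_gen[OF rep]) (intro sum.mono_neutral_right; auto)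
    also have "\<dots> = (\<Sum>j<Suc n. M (w i) (w' j) * ent (\<rho> (gen G (w' j))) q (Suc q))"
      by (rule sum.reindex_bij_betw[OF w'(1), symmetric])
    finally show ?thesis by (simp only: letter_def option.case)
  qed
  show "ent (\<rho> (letter v' w' (Some j))) q (Suc q) = 0" if "j \<le> n" "q \<notin> slots e n" for j q
  proof -
    have "w' j \<in> B" using w'(1) that(1) by (auto simp: bij_betw_def)
    then show ?thesis using w'(2) that(2) slot by (auto simp: letter_def)
  qed
  show "ent (\<rho> (\<phi> (letter v w None))) q (Suc q) = M v v' * ent (\<rho> (letter v' w' None)) q (Suc q)"
    if q: "q \<notin> slots e n" for q
  proof -
    \<comment> \<open>Off the slots only v1 and v2 have superdiagonal entries, and of these only v'
      can have a nonzero coefficient.\<close>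
    have "ent (\<rho> (\<phi> (gen G v))) q (Suc q) = (\<Sum>b \<in> {v'}. M v b * ent (\<rho> (gen G b)) q (Suc q))"
      unfolding ent_phi_gen[OF rep, of v] using v v' v12 q slot pair_finite_verts
      by (subst ent_phi_gen[OF rep], blast) (intro sum.mono_neutral_right; auto)
    then show ?thesis by (simp add: letter_def)
  qed
  have "{0..<width (nest_tree e n 0)} \<inter> slots e n = slots e n"
    by (auto simp: slots_def width_nest_tree)
  then show "card ({0..<width (nest_tree e n 0)} \<inter> slots e n) \<le> Suc n"
    using card_nest_word_Some[of e n 0] by (simp add: slots_def)
qed

text \<open>The p-th superdiagonal entry of a vertex is 1 if it is the p-th letter of
  \<open>nest_word\<close>. Adjacent vertices never follow each other there: the w_i are separated
  by v1, whose link is disjoint from that of v2. The vanishing on vertices outside the word is used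
  when \<phi> interchanges v1 and v2.\<close>

lemma exists_detecting_rep:
  assumes e: "e > 0" and w: "bij_betw w {..<Suc n} (lk G v2 - {v1})"
  shows "\<exists>\<rho> \<in> slot_reps (slots e n).
    alt_lead (Suc n) (\<lambda>l p. ent (\<rho> (letter v1 w l)) p (Suc p)) (nest_tree e n 0) = 1 \<and>
    (\<forall>u \<in> pverts G - insert v1 (lk G v2). \<forall>p. ent (\<rho> (gen G u)) p (Suc p) = 0)"
proof -
  let ?w = "nest_word e n 0"
  define f where "f v p = (if p < length ?w \<and> case_option v1 w (?w ! p) = v then 1 else 0 :: int)" for v p
  have wi: "w i \<in> lk G v2" "w i \<noteq> v1" if "i \<le> n" for i
    using w that by (auto simp: bij_betw_def)
  have idx: "i \<le> n" if "p < length ?w" "?w ! p = Some i" for p i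
    using Some_in_nest_word[of i e n 0] nth_mem[OF that(1)] that(2) by simp
  have not_adj: "\<not> (f a p \<noteq> 0 \<and> f b (Suc p) \<noteq> 0)" if ab: "(a, b) \<in> parcs G" for a b p
  proof
    assume "f a p \<noteq> 0 \<and> f b (Suc p) \<noteq> 0"
    then have p: "Suc p < length ?w" "case_option v1 w (?w ! p) = a" "case_option v1 w (?w ! Suc p) = b"
      by (auto simp: f_def split: if_splits)
    have no: "(v1, w i) \<notin> parcs G" "(w i, v1) \<notin> parcs G" if "i \<le> n" for i
      using wi[OF that] lk_disjoint arcs_symmetric[of "w i" v1] by (auto simp: in_lk[symmetric])
    show False
      using p ab nest_word_separated[OF e p(1)] no no_loops'[of v1] idx[of p] idx[of "Suc p"]
      by (cases "?w ! p"; cases "?w ! Suc p") auto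
  qed
  have "f a p * f b (Suc p) = f b p * f a (Suc p)" if "(a, b) \<in> parcs G" for a b p
    using not_adj[OF that, of p] not_adj[OF arcs_symmetric[OF that], of p] by auto
  then obtain \<rho> where \<rho>: "unirep (raag G) \<rho>" "\<And>v. v \<in> pverts G \<Longrightarrow> \<rho> (gen G v) = 1 + superdiag (f v)"
    using unirep_from_superdiag[of G f] by blast
  have ent: "ent (\<rho> (gen G v)) p (Suc p) = f v p" if "v \<in> pverts G" for v p
    using \<rho>(2)[OF that] by (simp add: superdiag.rep_eq)
  have "\<rho> \<in> slot_reps (slots e n)"
    using \<rho>(1) by (auto simp: slot_reps_def slots_def ent f_def split: option.splits)
  moreover have "f (case_option v1 w l) p = word_coeff ?w l p" if l: "l \<noteq> None \<longrightarrow> the l \<le> n" for l p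
  proof -
    have "case_option v1 w (?w ! p) = case_option v1 w l \<longleftrightarrow> ?w ! p = l" if p: "p < length ?w"
    proof -
      have "w i = w j \<longleftrightarrow> i = j" if "i \<le> n" "j \<le> n" for i j
        using inj_onD[OF bij_betw_imp_inj_on[OF w], of i j] that by auto
      then show ?thesis
        using l idx[OF p] wi(2) wi(2)[symmetric]
        by (cases "?w ! p" rule: option.exhaust; cases l rule: option.exhaust) auto
    qed
    then show ?thesis by (cases "p < length ?w") (simp_all add: f_def word_coeff_def)
  qed
  then have "alt_lead (Suc n) (\<lambda>l p. ent (\<rho> (letter v1 w l)) p (Suc p)) (nest_tree e n 0) =
      alt_lead (Suc n) (word_coeff ?w) (nest_tree e n 0)"
    unfolding alt_lead_def
  proof (intro sum.cong HOL.refl arg_cong2[where f = times] lead_cong ext)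
    fix \<sigma> l p
    assume \<sigma>: "\<sigma> \<in> {\<sigma>. \<sigma> permutes {0..<Suc n}}" and l: "l \<in> set_comm_tree (nest_tree e n 0)"
    have le: "map_option \<sigma> l \<noteq> None \<longrightarrow> the (map_option \<sigma> l) \<le> n"
    proof (cases l rule: option.exhaust)
      case (Some i)
      then have "i < Suc n" using l by (simp add: Some_in_nest_tree)
      then show ?thesis
        using \<sigma> permutes_in_image[of \<sigma> "{0..<Suc n}" i] Some by (simp add: less_Suc_eq_le)
    qed simp
    then have "case_option v1 w (map_option \<sigma> l) \<in> pverts G"
      using v12 wi by (cases "map_option \<sigma> l" rule: option.exhaust) (auto simp: lk_def)
    then show "ent (\<rho> (letter v1 w (map_option \<sigma> l))) p (Suc p) = word_coeff ?w (map_option \<sigma> l) p"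
      using \<open>\<And>l p. l \<noteq> None \<longrightarrow> the l \<le> n \<Longrightarrow> f (case_option v1 w l) p = word_coeff ?w l p\<close>[OF le]
      by (simp add: letter_def ent)
  qed
  moreover have "ent (\<rho> (gen G u)) p (Suc p) = 0" if u: "u \<in> pverts G - insert v1 (lk G v2)" for u p
  proof -
    have "case_option v1 w (?w ! p) \<noteq> u" if "p < length ?w"
      using u wi(1) idx[OF that] by (cases "?w ! p") auto
    then show ?thesis using u by (simp add: ent f_def)
  qed
  ultimately show ?thesis
    using alt_lead_word[OF e] by (intro bexI[of _ \<rho>]) auto
qed

end

text \<open>The exponent has the parity of e, so e = 1 or e = 2 produces the sign needed.\<close>

lemma sign_choice:
  fixes d :: int
  assumes "d \<in> {1, - 1}"
  shows "\<exists>e>0. \<forall>n. (- 1) ^ (2 * e * n + e) * d = 1"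
  using assms by (auto simp: power_add power_mult intro: exI[of _ 1] exI[of _ 2])

section \<open>The cases of a diagonal and an antidiagonal block at v1, v2\<close>

context split_aut
begin

lemma sub_other: "lk G v2 - {v1} \<subseteq> pverts G - {v1, v2}" "lk G v1 - {v2} \<subseteq> pverts G - {v1, v2}"
  using no_loops'[of v1 v1] no_loops'[of v2 v2] by (auto simp: lk_def)

lemma phi_invariant:
  assumes "additive_on (raag G) \<chi>" "\<And>a. a \<in> pverts G \<Longrightarrow> (\<Sum>b \<in> pverts G. M a b * \<chi> (gen G b)) = \<chi> (gen G a)"
    and "g \<in> carrier (raag G)"
  shows "\<chi> (\<phi> g) = \<chi> g"
  using additive_on_expand[OF pair_finite_verts additive_on_phi[OF assms(1)] assms(3)]
    additive_on_expand[OF pair_finite_verts assms(1,3)] assms(2)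
  by (simp add: additive_phi_gen[OF assms(1)])

text \<open>The equations say that \<phi> preserves the character with value 1 at v1, s at v2 and 0
  at the other vertices. It serves s = 0 in the diagonal case and s = \<open>M v1 v2\<close> in the
  antidiagonal one.\<close>

lemma reidemeister_fixed_character:
  assumes eq: "M v1 v1 + s * M v1 v2 = 1" "M v2 v1 + s * M v2 v2 = s"
  shows "reidemeister_number (raag G) \<phi> = \<infinity>"
proof -
  interpret group "raag G" by (rule group_raag)
  define \<chi> where "\<chi> g = expo G v1 g + s * expo G v2 g" for g
  have add: "additive_on (raag G) \<chi>"
    using additive_on_expo[of G v1] additive_on_expo[of G v2]
    by (simp add: additive_on_def \<chi>_def distrib_left)
  have \<chi>_gen: "\<chi> (gen G b) = (if b = v1 then 1 else if b = v2 then s else 0)" if "b \<in> pverts G" for b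
    using that v1_neq_v2 by (simp add: \<chi>_def expo_gen)
  have sum: "(\<Sum>b \<in> pverts G. M a b * \<chi> (gen G b)) = M a v1 + s * M a v2" for a
  proof -
    have "(\<Sum>b \<in> pverts G. M a b * \<chi> (gen G b)) = (\<Sum>b \<in> {v1, v2}. M a b * \<chi> (gen G b))"
      using v12 pair_finite_verts by (intro sum.mono_neutral_right) (auto simp: \<chi>_gen)
    then show ?thesis using v12 v1_neq_v2 by (simp add: \<chi>_gen mult.commute)
  qed
  have "(\<Sum>b \<in> pverts G. M a b * \<chi> (gen G b)) = \<chi> (gen G a)" if a: "a \<in> pverts G" for a
    unfolding sum \<chi>_gen[OF a] using eq M_other_v1[of a] M_other_v2[of a] a by auto
  then show ?thesis
    using phi_invariant[OF add] v12
    by (intro reidemeister_number_additive[OF phi add _ gen_closed[OF v12(1)]]) (auto simp: \<chi>_gen)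
qed

lemma exists_enumeration:
  obtains n w where "bij_betw w {..<Suc n} (lk G v2 - {v1})"
proof -
  have "finite (lk G v2 - {v1})"
    using pair_finite_verts by (simp add: lk_def)
  moreover have "lk G v2 - {v1} \<noteq> {}" using proper by auto
  ultimately have "card (lk G v2 - {v1}) \<noteq> 0" by (metis card_0_eq)
  then obtain n where "card (lk G v2 - {v1}) = Suc n" by (metis not0_implies_Suc)
  then show thesis
    using ex_bij_betw_nat_finite[OF \<open>finite (lk G v2 - {v1})\<close>] that by (auto simp: lessThan_atLeast0)
qed

text \<open>Here \<phi> preserves the span of W2 and multiplies the corner entry of the Lie element
  z by (-1)^(2en + e) times the determinant on W2; e is chosen to make this factor 1.\<close>

lemma reidemeister_diagonal:
  assumes M: "M v1 v2 = 0" "M v1 v1 = - 1" "M v2 v2 \<noteq> 0"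
  shows "reidemeister_number (raag G) \<phi> = \<infinity>"
proof -
  obtain n w where w: "bij_betw w {..<Suc n} (lk G v2 - {v1})" by (rule exists_enumeration)
  let ?B = "lk G v2 - {v1}"
  note B = sub_other(1)
  have wB: "w i \<in> ?B" if "i \<le> n" for i using w that by (auto simp: bij_betw_def)
  have wV: "w i \<in> pverts G" if "i \<le> n" for i using wB[OF that] by (simp add: lk_def)
  have supp: "M a b = 0" if "a \<in> ?B" "b \<in> pverts G - ?B" for a b
    using that M(3) by (intro M_support_lk[of v2]) auto
  let ?d = "det (mat (Suc n) (Suc n) (\<lambda>(i, j). M (w i) (w j)))"
  have "?d \<in> {1, - 1}"
    using B by (intro det_M_support[OF w _ w] supp) auto
  then obtain e where e: "e > 0" "(- 1) ^ (2 * e * n + e) * ?d = 1"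
    using sign_choice by blast
  let ?c = "width (nest_tree e n 0)"
  obtain z where z: "z \<in> carrier (raag G)"
    and z_deep: "\<And>\<rho>. unirep (raag G) \<rho> \<Longrightarrow> depth_ge ?c (\<rho> z - 1)"
    and z_lead: "\<And>\<rho>. unirep (raag G) \<rho> \<Longrightarrow> ent (\<rho> z) 0 ?c =
      alt_lead (Suc n) (\<lambda>l p. ent (\<rho> (letter v1 w l)) p (Suc p)) (nest_tree e n 0)"
    using exists_lie_element[OF v12(1), of n w e] wV by blast
  obtain \<rho>0 where \<rho>0: "\<rho>0 \<in> slot_reps (slots e n)"
    "alt_lead (Suc n) (\<lambda>l p. ent (\<rho>0 (letter v1 w l)) p (Suc p)) (nest_tree e n 0) = 1"
    using exists_detecting_rep[OF e(1) w] by blast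
  have rep: "unirep (raag G) \<rho>" if "\<rho> \<in> slot_reps (slots e n)" for \<rho>
    using that by (simp add: slot_reps_def)
  have "ent (\<rho> (\<phi> z)) 0 ?c = ent (\<rho> z) 0 ?c" if \<rho>: "\<rho> \<in> slot_reps (slots e n)" for \<rho>
  proof -
    have "ent (\<rho> (\<phi> z)) 0 ?c = (M v1 v1 ^ (2 * e * n + e) * ?d) * ent (\<rho> z) 0 ?c"
      unfolding z_lead[OF unirep_phi[OF rep[OF \<rho>]]] z_lead[OF rep[OF \<rho>]]
      by (rule alt_lead_phi[OF \<rho> _ _ _ wV w B supp]) (use M wB in auto)
    then show ?thesis using e(2) M by simp
  qed
  then show ?thesis
    using \<rho>0 z_lead[OF rep[OF \<rho>0(1)]]
    by (intro reidemeister_number_infinite_of_fixed_central[where R = "slot_reps (slots e n)" and c = ?c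
          and \<phi> = \<phi> and y = z and ?\<rho>0.0 = \<rho>0] pair_finite_verts phi rep slot_reps_phi z z_deep width_pos) auto
qed

text \<open>Now \<phi> leads from z to the mirrored element on v2 and W1 and back. The total factor
  is (-1)^(2en + e) times both determinants; once e makes it 1, the product of z and \<phi>(z) is
  fixed at the corner.\<close>

lemma reidemeister_antidiagonal:
  assumes M: "M v1 v1 = 0" "M v2 v2 = 0" "M v1 v2 * M v2 v1 = - 1"
  shows "reidemeister_number (raag G) \<phi> = \<infinity>"
proof -
  interpret group "raag G" by (rule group_raag)
  interpret swapped: split_aut G \<phi> \<psi> v2 v1 by (rule swap)
  let ?B = "lk G v2 - {v1}" and ?B' = "lk G v1 - {v2}"
  note B = sub_other
  have nz: "M v1 v2 \<noteq> 0" "M v2 v1 \<noteq> 0" using M(3) by auto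
  have supp: "M a b = 0" if "a \<in> ?B" "b \<in> pverts G - ?B'" for a b
    using that nz by (intro M_support_lk[of v1]) auto
  have supp': "M a b = 0" if "a \<in> ?B'" "b \<in> pverts G - ?B" for a b
    using that nz by (intro swapped.M_support_lk[of v2]) auto
  \<comment> \<open>The supports in both directions force equal sizes, so that the two blocks are
    square.\<close>
  have card: "card ?B = card ?B'"
    using B supp supp' by (intro antisym M_support_card_le) auto
  obtain n w where w: "bij_betw w {..<Suc n} ?B" by (rule exists_enumeration)
  have "finite ?B'" using pair_finite_verts by (simp add: lk_def)
  moreover have "card ?B' = Suc n" using bij_betw_same_card[OF w] card by simp
  ultimately obtain w' where w': "bij_betw w' {..<Suc n} ?B'"
    using ex_bij_betw_nat_finite[of ?B'] by (auto simp: lessThan_atLeast0)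
  have wB: "w i \<in> ?B" "w' i \<in> ?B'" if "i \<le> n" for i
    using w w' that by (auto simp: bij_betw_def)
  have wV: "w i \<in> pverts G" "w' i \<in> pverts G" if "i \<le> n" for i
    using wB[OF that] by (simp_all add: lk_def)
  let ?d = "det (mat (Suc n) (Suc n) (\<lambda>(i, j). M (w i) (w' j)))"
  let ?d' = "det (mat (Suc n) (Suc n) (\<lambda>(i, j). M (w' i) (w j)))"
  have "?d \<in> {1, - 1}"
    using B by (intro det_M_support[OF w _ w'] supp) auto
  moreover have "?d' \<in> {1, - 1}"
    using B by (intro det_M_support[OF w' _ w] supp') auto
  ultimately have "?d * ?d' \<in> {1, - 1}" by auto
  then obtain e where e: "e > 0" "(- 1) ^ (2 * e * n + e) * (?d * ?d') = 1"
    using sign_choice by blast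
  let ?t = "nest_tree e n 0"
  let ?c = "width ?t" and ?N = "2 * e * n + e"
  obtain z where z: "z \<in> carrier (raag G)"
    and z_deep: "\<And>\<rho>. unirep (raag G) \<rho> \<Longrightarrow> depth_ge ?c (\<rho> z - 1)"
    and z_lead: "\<And>\<rho>. unirep (raag G) \<rho> \<Longrightarrow> ent (\<rho> z) 0 ?c =
      alt_lead (Suc n) (\<lambda>l p. ent (\<rho> (letter v1 w l)) p (Suc p)) ?t"
    using exists_lie_element[OF v12(1), of n w e] wV by blast
  obtain \<rho>0 where \<rho>0: "\<rho>0 \<in> slot_reps (slots e n)"
    "alt_lead (Suc n) (\<lambda>l p. ent (\<rho>0 (letter v1 w l)) p (Suc p)) ?t = 1"
    and \<rho>0_zero: "\<And>u p. u \<in> pverts G - insert v1 (lk G v2) \<Longrightarrow> ent (\<rho>0 (gen G u)) p (Suc p) = 0"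
    using exists_detecting_rep[OF e(1) w] by blast
  have rep: "unirep (raag G) \<rho>" if "\<rho> \<in> slot_reps (slots e n)" for \<rho>
    using that by (simp add: slot_reps_def)
  let ?z' = "\<lambda>\<rho>. alt_lead (Suc n) (\<lambda>l p. ent (\<rho> (letter v2 w' l)) p (Suc p)) ?t"
  have phi_z: "ent (\<rho> (\<phi> z)) 0 ?c = M v1 v2 ^ ?N * ?d * ?z' \<rho>"
    if \<rho>: "\<rho> \<in> slot_reps (slots e n)" for \<rho>
    unfolding z_lead[OF unirep_phi[OF rep[OF \<rho>]]]
    by (rule alt_lead_phi[OF \<rho> _ _ _ wV(1) w' B(2) supp]) (use M wB in auto)
  have phi_z': "?z' (\<lambda>g. \<rho> (\<phi> g)) = M v2 v1 ^ ?N * ?d' * ent (\<rho> z) 0 ?c"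
    if \<rho>: "\<rho> \<in> slot_reps (slots e n)" for \<rho>
    unfolding z_lead[OF rep[OF \<rho>]]
    by (rule alt_lead_phi[OF \<rho> _ _ _ wV(2) w B(1) supp']) (use M wB in auto)
  have phi_phi: "ent (\<rho> (\<phi> (\<phi> z))) 0 ?c = ent (\<rho> z) 0 ?c" if \<rho>: "\<rho> \<in> slot_reps (slots e n)" for \<rho>
  proof -
    have "ent (\<rho> (\<phi> (\<phi> z))) 0 ?c = (M v1 v2 * M v2 v1) ^ ?N * (?d * ?d') * ent (\<rho> z) 0 ?c"
      using phi_z[OF slot_reps_phi[OF \<rho>]] phi_z'[OF \<rho>] by (simp add: power_mult_distrib)
    then show ?thesis using e(2) M(3) by simp
  qed
  let ?y = "z \<otimes>\<^bsub>raag G\<^esub> \<phi> z"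
  have y: "depth_ge ?c (\<rho> ?y - 1)" "ent (\<rho> ?y) 0 ?c = ent (\<rho> z) 0 ?c + ent (\<rho> (\<phi> z)) 0 ?c"
    if \<rho>: "\<rho> \<in> slot_reps (slots e n)" for \<rho>
    using unirep_mult_lead[OF rep[OF \<rho>] width_pos z z_deep[OF rep[OF \<rho>]] phi_closed[OF z]
        z_deep[OF unirep_phi[OF rep[OF \<rho>]]]] by auto
  have fixed: "ent (\<rho> (\<phi> ?y)) 0 ?c = ent (\<rho> ?y) 0 ?c" if \<rho>: "\<rho> \<in> slot_reps (slots e n)" for \<rho>
    using y(2)[OF \<rho>] y(2)[OF slot_reps_phi[OF \<rho>]] phi_phi[OF \<rho>] by simp
  \<comment> \<open>\<open>\<rho>0\<close> has zero superdiagonal on v2 and W1, so \<phi>(z) cannot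
    cancel the corner entry of z.\<close>
  have "?z' \<rho>0 = 0"
  proof -
    have "ent (\<rho>0 (letter v2 w' (map_option \<sigma> l))) q (Suc q) = 0"
      if \<sigma>: "\<sigma> permutes {0..<Suc n}" and l: "l \<in> set_comm_tree ?t" for \<sigma> l q
    proof (cases l rule: option.exhaust)
      case None
      then show ?thesis
        using \<rho>0_zero[of v2] v12 v1_neq_v2 no_loops'[of v2 v2] by (auto simp: letter_def in_lk)
    next
      case (Some i)
      then have "i < Suc n" using l by (simp add: Some_in_nest_tree)
      then have "\<sigma> i \<le> n" using permutes_in_image[OF \<sigma>, of i] by (simp add: less_Suc_eq_le)
      then have "w' (\<sigma> i) \<in> pverts G - insert v1 (lk G v2)"
        using wB(2)[of "\<sigma> i"] B(2) lk_disjoint by auto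
      then show ?thesis using \<rho>0_zero Some by (simp add: letter_def)
    qed
    then have "lead (\<lambda>l p. ent (\<rho>0 (letter v2 w' (map_option \<sigma> l))) p (Suc p)) ?t 0 = 0"
      if "\<sigma> permutes {0..<Suc n}" for \<sigma>
      using that by (intro lead_eq_0[where Q = "\<lambda>l. l \<noteq> None" and S = "{}"])
        (auto simp: count_nest_tree_not_None simp del: not_None_eq)
    then show ?thesis by (simp add: alt_lead_def)
  qed
  then have "ent (\<rho>0 ?y) 0 ?c \<noteq> 0"
    using y(2)[OF \<rho>0(1)] phi_z[OF \<rho>0(1)] z_lead[OF rep[OF \<rho>0(1)]] \<rho>0(2) by simp
  then show ?thesis
    using z phi_closed[OF z] \<rho>0(1)
    by (intro reidemeister_number_infinite_of_fixed_central[where R = "slot_reps (slots e n)" and c = ?c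
          and \<phi> = \<phi> and y = ?y and ?\<rho>0.0 = \<rho>0] pair_finite_verts phi rep slot_reps_phi y(1) fixed
          width_pos) auto
qed

lemma reidemeister_number_infinite: "reidemeister_number (raag G) \<phi> = \<infinity>"
  using M_monomial
proof (elim disjE conjE)
  assume M: "M v1 v2 = 0" "M v2 v1 = 0" "M v1 v1 \<in> {1, - 1}" "M v2 v2 \<in> {1, - 1}"
  show ?thesis
  proof (cases "M v1 v1 = 1")
    case True
    then show ?thesis using M by (intro reidemeister_fixed_character[of 0]) auto
  next
    case False
    then show ?thesis using M by (intro reidemeister_diagonal) auto
  qed
next
  assume M: "M v1 v1 = 0" "M v2 v2 = 0" "M v1 v2 \<in> {1, - 1}" "M v2 v1 \<in> {1, - 1}"
  show ?thesis
  proof (cases "M v1 v2 = M v2 v1")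
    case True
    then show ?thesis using M by (intro reidemeister_fixed_character[of "M v1 v2"]) auto
  next
    case False
    then show ?thesis using M by (intro reidemeister_antidiagonal) auto
  qed
qed

end

section \<open>Derivation of the theorem from the locale \<open>split_aut\<close>\<close>

theorem corollary6p2p6:
  fixes G :: "'v pair_pre_digraph" and n d :: nat and v1 v2 :: 'v
  assumes "max_by_abelian n (n - 2) d G"
    and "{v1, v2} = pverts G - max_verts G"
    and "lk G v1 \<union> lk G v2 = pverts G"
    and "lk G v1 \<inter> lk G v2 = {}"
  shows "R_infinity (raag G)"
proof -
  have pg: "pair_graph G" using assms(1) by (simp add: max_by_abelian_def)
  then interpret pair_graph G .
  have v12: "v1 \<in> pverts G" "v2 \<in> pverts G" using assms(2) by auto
  have fin: "finite (lk G v)" for v using pair_finite_verts by (simp add: lk_def)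
  note deg = degree_eq_card_lk[OF pg]
  have le_max: "card (lk G v) \<le> max_degree G" if "v \<in> pverts G" for v
    unfolding max_degree_def deg using that pair_finite_verts by (intro Max_ge) auto
  have less_max: "card (lk G v1) < max_degree G" "card (lk G v2) < max_degree G"
    using le_max[OF v12(1)] le_max[OF v12(2)] assms(2) v12 by (auto simp: max_verts_def deg)
  have "max_degree G \<in> (\<lambda>v. card (lk G v)) ` pverts G"
    unfolding max_degree_def deg using pair_finite_verts v12 by (intro Max_in) auto
  then obtain m where m: "m \<in> pverts G" "card (lk G m) = max_degree G" by auto
  have not_self: "v \<notin> lk G v" for v using no_loops'[of v v] by (auto simp: lk_def)
  \<comment> \<open>Otherwise b is adjacent to all other vertices, so its degree is at least |V| -
    1, which bounds every degree; but the degree of b is not maximal.\<close>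
  have proper: "\<not> lk G a \<subseteq> {b}"
    if ab: "b \<in> pverts G" "lk G a \<union> lk G b = pverts G" "card (lk G b) < max_degree G" for a b
  proof
    assume "lk G a \<subseteq> {b}"
    then have "pverts G - {b} \<subseteq> lk G b" using ab(2) by auto
    then have "card (pverts G) - 1 \<le> card (lk G b)"
      using card_mono[OF fin, of "pverts G - {b}" b] ab(1) by (simp add: card_Diff_singleton)
    moreover have "lk G m \<subseteq> pverts G - {m}" using not_self by (auto simp: lk_def)
    then have "card (lk G m) \<le> card (pverts G) - 1"
      using card_mono[of "pverts G - {m}" "lk G m"] pair_finite_verts m(1) by simp
    ultimately show False using m(2) ab(3) by simp
  qed
  have other: "card (lk G v1) < card (lk G w) \<and> card (lk G v2) < card (lk G w)"
    if "w \<in> pverts G" "w \<noteq> v1" "w \<noteq> v2" for w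
  proof -
    have "w \<in> max_verts G" using that assms(2) by blast
    then show ?thesis using less_max by (simp add: max_verts_def deg)
  qed
  have "reidemeister_number (raag G) \<phi> = \<infinity>" if "\<phi> \<in> auto (raag G)" for \<phi>
  proof -
    interpret group "raag G" by (rule group_raag)
    have iso: "\<phi> \<in> iso (raag G) (raag G)"
      using that by (auto simp: auto_def iso_def Bij_def)
    then have bij: "bij_betw \<phi> (carrier (raag G)) (carrier (raag G))" by (simp add: iso_def)
    interpret split_aut G \<phi> "inv_into (carrier (raag G)) \<phi>" v1 v2
    proof unfold_locales
      show "inv_into (carrier (raag G)) \<phi> \<in> hom (raag G) (raag G)"
        using iso_set_sym[OF iso] by (simp add: iso_def)
      show "inv_into (carrier (raag G)) \<phi> (\<phi> g) = g" if "g \<in> carrier (raag G)" for g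
        using bij that by (simp add: bij_betw_inv_into_left)
      show "\<phi> (inv_into (carrier (raag G)) \<phi> g) = g" if "g \<in> carrier (raag G)" for g
        using bij that by (simp add: bij_betw_inv_into_right)
    qed (use pg iso v12 assms(3,4) other proper[of v2 v1] proper[of v1 v2] less_max in \<open>auto simp: iso_def\<close>)
    show ?thesis by (rule reidemeister_number_infinite)
  qed
  then show ?thesis by (simp add: R_infinity_def)
qed

end
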